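(* Let $p\ge4$ and let $\omega,c\in\mathbb{R}$ with $c^2<4\omega$ be fixed. For $b>0$ let $\varphi=\varphi_{\omega,c}$ be the positive, even $H^1(\mathbb{R})$ solution of $$-\varphi_{xx}+\left(\omega-\tfrac{c^2}{4}\right)\varphi+\tfrac{c}{2}|\varphi|^2\varphi-\tfrac{3}{16}|\varphi|^4\varphi-b|\varphi|^p\varphi=0,$$ and let $\varphi_0$ be the corresponding solution for $b=0$. Then, for $b$ sufficiently small, $$\|\varphi-\varphi_0\|_{L^\infty}=O(\sqrt[4]{b}),\qquad \|\varphi-\varphi_0\|_{L^2}=O(\sqrt[4]{b}).$$ Moreover, $$\|\partial_\omega\varphi-\partial_\omega\varphi_0\|_{L^2}=O(\sqrt[4]{b})\qquad\text{and}\qquad \|\partial_c\varphi-\partial_c\varphi_0\|_{L^2}=O(\sqrt[4]{b}).$$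
   Context: $O(\sqrt[4]{b})$ denotes a quantity bounded by $C\sqrt[4]{b}$ with a constant $C>0$ independent of $b$ (as $b\downarrow0$, with $\omega,c,p$ fixed). $\partial_\omega\varphi$ and $\partial_c\varphi$ are the derivatives of the profile with respect to the parameters $\omega$ and $c$ (with $b,p$ fixed). Explicitly, with $a=\omega-\frac{c^2}{4}>0$, $\varphi_0>0$ and $$\varphi_0^2(x)=\frac{8a}{\sqrt{c^2+4a}\cosh(\sqrt{4a}\,x)-c}.$$ *)

theory Defs
  imports "HOL-Probability.Essential_Supremum"
begin

definition L2 :: "(real \<Rightarrow> real) set" where
  "L2 = {f. f \<in> borel_measurable lborel \<and> integrable lborel (\<lambda>x. (f x)\<^sup>2)}"

(* Meaningful only on L2: outside of it the Bochner integral defaults to 0. *)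
definition L2_norm :: "(real \<Rightarrow> real) \<Rightarrow> real" where
  "L2_norm f = sqrt (LINT x|lborel. (f x)\<^sup>2)"

(* Extended-real valued: an unbounded function has norm infinity. *)
definition Linf_norm :: "(real \<Rightarrow> real) \<Rightarrow> ereal" where
  "Linf_norm f = esssup lborel (\<lambda>x. ereal \<bar>f x\<bar>)"

definition test_function :: "(real \<Rightarrow> real) \<Rightarrow> bool" where
  "test_function \<psi> \<longleftrightarrow>
     (\<forall>n x. (deriv ^^ n) \<psi> field_differentiable (at x)) \<and> compact (closure {x. \<psi> x \<noteq> 0})"

definition weak_derivative :: "(real \<Rightarrow> real) \<Rightarrow> (real \<Rightarrow> real) \<Rightarrow> bool" where
  "weak_derivative f g \<longleftrightarrow>
     (\<forall>\<psi>. test_function \<psi> \<longrightarrow>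
        (LINT x|lborel. f x * deriv \<psi> x) = - (LINT x|lborel. g x * \<psi> x))"

definition H1 :: "(real \<Rightarrow> real) set" where
  "H1 = {f. f \<in> L2 \<and> (\<exists>g\<in>L2. weak_derivative f g)}"

(* The differentiability conditions are needed because deriv is total in HOL. *)
definition solves_profile_eq ::
    "real \<Rightarrow> real \<Rightarrow> real \<Rightarrow> real \<Rightarrow> (real \<Rightarrow> real) \<Rightarrow> bool" where
  "solves_profile_eq p b \<omega> c \<phi> \<longleftrightarrow>
     (\<forall>x. \<phi> field_differentiable (at x) \<and> deriv \<phi> field_differentiable (at x) \<and>
        - deriv (deriv \<phi>) x + (\<omega> - c\<^sup>2 / 4) * \<phi> x + c / 2 * \<bar>\<phi> x\<bar>^2 * \<phi> x
          - 3 / 16 * \<bar>\<phi> x\<bar>^4 * \<phi> x - b * \<bar>\<phi> x\<bar> powr p * \<phi> x = 0)"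

definition is_profile ::
    "real \<Rightarrow> real \<Rightarrow> real \<Rightarrow> real \<Rightarrow> (real \<Rightarrow> real) \<Rightarrow> bool" where
  "is_profile p b \<omega> c \<phi> \<longleftrightarrow>
     \<phi> \<in> H1 \<and> (\<forall>x. \<phi> x > 0) \<and> (\<forall>x. \<phi> (- x) = \<phi> x) \<and> solves_profile_eq p b \<omega> c \<phi>"

(* Families of profiles are indexed as \<phi> b \<omega> c x. *)

definition d_omega ::
    "(real \<Rightarrow> real \<Rightarrow> real \<Rightarrow> real \<Rightarrow> real) \<Rightarrow> real \<Rightarrow> real \<Rightarrow> real \<Rightarrow> real \<Rightarrow> real" where
  "d_omega \<phi> b \<omega> c x = deriv (\<lambda>w. \<phi> b w c x) \<omega>"

definition d_c ::
    "(real \<Rightarrow> real \<Rightarrow> real \<Rightarrow> real \<Rightarrow> real) \<Rightarrow> real \<Rightarrow> real \<Rightarrow> real \<Rightarrow> real \<Rightarrow> real" where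
  "d_c \<phi> b \<omega> c x = deriv (\<lambda>k. \<phi> b \<omega> k x) c"

definition param_differentiable ::
    "(real \<Rightarrow> real \<Rightarrow> real \<Rightarrow> real \<Rightarrow> real) \<Rightarrow> real \<Rightarrow> real \<Rightarrow> real \<Rightarrow> bool" where
  "param_differentiable \<phi> b \<omega> c \<longleftrightarrow>
     (\<forall>x. (\<lambda>w. \<phi> b w c x) field_differentiable (at \<omega>) \<and>
          (\<lambda>k. \<phi> b \<omega> k x) field_differentiable (at c))"

end

theory Submission
  imports Defs "HOL-Probability.Distributions"
begin

text \<open>
  The reciprocal square \<open>u = 1 / \<phi>\<^sup>2\<close> of a profile nearly linearises the problem. A square integrable
  profile has zero energy (\<open>profile_first_integral\<close>), and inserting this into \<open>u''\<close> gives, with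
  \<open>a = \<omega> - c\<^sup>2 / 4\<close>, \<open>r = (p - 2) / 2\<close> and \<open>\<gamma> = 2 (p - 4) / (p + 2)\<close>,
  
    \<open>u'' = 4 a u + c / 2 + b \<gamma> u^(-r)\<close>, with \<open>u' 0 = 0\<close>,
  
  where \<open>u 0\<close> is the root of an explicit scalar equation (\<open>reciprocal_profile_of_profile\<close>). For \<open>p \<ge> 4\<close>
  the perturbation is nonnegative, and it is smooth in \<open>u\<close> because \<open>u\<close> is bounded below: it lies above a
  multiple of \<open>cosh (2 \<surd>a x)\<close> (\<open>reciprocal_profile_lower_bound\<close>). So everything should depend on the
  parameters, \<open>b\<close> included, as for a linear equation, with errors of order \<open>b\<close>.
  
  The quantitative form of this is one comparison principle (\<open>cosh_bound_of_linear_ode\<close>): if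
  \<open>y'' - P y = O(cosh (\<mu> x))\<close> with \<open>0 \<le> P \<le> k < \<mu>\<^sup>2\<close> and \<open>y' 0 = 0\<close>, then \<open>y = O(cosh (\<mu> x))\<close> with explicit
  constants. Applied to differences of solutions it shows that \<open>u\<close> is Lipschitz in \<open>(b, a, c)\<close>
  (\<open>sol_lipschitz\<close>). Applied to differences of difference quotients along a curve of parameters it shows
  that these are Cauchy (\<open>quotient_cauchy\<close>), so that the parameter derivative \<open>V\<close> of \<open>u\<close> exists, and that the
  quotients for \<open>b\<close> and for \<open>0\<close> differ by \<open>O(b)\<close> up to a term that vanishes with the increment
  (\<open>quotient_b_lipschitz\<close>).
  
  Finally \<open>\<phi> = u^(-1/2)\<close> and \<open>\<partial>\<phi> = - u^(-3/2) V / 2\<close>. The differences of \<open>u\<close> and \<open>V\<close> grow at most like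
  \<open>b cosh (\<mu> x)\<close>, where \<open>\<mu>\<close> may be taken close to \<open>2 \<surd>a\<close>, and the negative powers of \<open>u\<close> decay faster.
  The differences of the profiles and of their parameter derivatives are therefore bounded by
  \<open>C b e^(-\<surd>a \<bar>x\<bar> / 2)\<close> (\<open>profile_curve_estimate\<close>), which gives the rate \<open>b\<close> in every norm, and
  \<open>b \<le> root 4 b\<close> for \<open>b \<le> 1\<close>.
\<close>

section \<open>A comparison principle for linear second order equations\<close>

text \<open>
  Up to the first zero of \<open>z\<close> the second derivative is nonnegative, so \<open>z'\<close> stays nonnegative and
  \<open>z\<close> stays above \<open>z 0\<close>; hence that zero cannot exist.
\<close>
lemma pos_of_second_derivative_ge_halfline:
  fixes z z' z'' P :: "real \<Rightarrow> real"
  assumes z: "\<And>x. 0 \<le> x \<Longrightarrow> (z has_real_derivative z' x) (at x)"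
    and z': "\<And>x. 0 \<le> x \<Longrightarrow> (z' has_real_derivative z'' x) (at x)"
    and ge: "\<And>x. 0 \<le> x \<Longrightarrow> P x * z x \<le> z'' x"
    and P: "\<And>x. 0 \<le> x \<Longrightarrow> 0 \<le> P x"
    and init: "0 < z 0" "0 \<le> z' 0"
    and x: "0 \<le> x"
  shows "0 < z x"
proof (rule ccontr)
  assume "\<not> 0 < z x"
  define S where "S = {y\<in>{0..x}. z y \<le> 0}"
  have cont: "continuous_on {0..x} z"
    using z by (meson DERIV_isCont atLeastAtMost_iff continuous_at_imp_continuous_on)
  have "closed S"
    unfolding S_def using continuous_on_closed_Collect_le[OF cont continuous_on_const] by simp
  moreover have "x \<in> S" using x \<open>\<not> 0 < z x\<close> by (simp add: S_def)
  moreover have bdd: "bdd_below S" by (rule bdd_belowI[of _ 0]) (auto simp: S_def)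
  ultimately have "Inf S \<in> S" using closed_contains_Inf[of S] by blast
  define y where "y = Inf S"
  have y: "0 \<le> y" "z y \<le> 0" using \<open>Inf S \<in> S\<close> by (auto simp: S_def y_def)
  have "y \<le> x" using \<open>Inf S \<in> S\<close> by (auto simp: S_def y_def)
  have "0 < y" using y init by (cases "y = 0") auto
  have pos: "0 < z s" if "0 \<le> s" "s < y" for s
  proof (rule ccontr)
    assume "\<not> 0 < z s"
    then have "s \<in> S" using that \<open>y \<le> x\<close> by (simp add: S_def)
    then have "y \<le> s" unfolding y_def using bdd by (rule cInf_lower)
    then show False using that by simp
  qed
  have mono: "0 \<le> z' s" if "0 \<le> s" "s < y" for s
  proof -
    have "z' 0 \<le> z' s"
    proof (rule DERIV_nonneg_imp_nondecreasing[OF \<open>0 \<le> s\<close>])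
      fix r assume r: "0 \<le> r" "r \<le> s"
      have "0 \<le> P r * z r" using pos[of r] P[of r] r that by simp
      then show "\<exists>d. (z' has_real_derivative d) (at r) \<and> 0 \<le> d"
        using z'[OF r(1)] ge[OF r(1)] by (intro exI[of _ "z'' r"]) auto
    qed
    then show ?thesis using init by simp
  qed
  obtain s where s: "0 < s" "s < y" "z y - z 0 = (y - 0) * z' s"
    using MVT2[OF \<open>0 < y\<close>, of z z'] z by auto
  have "0 \<le> (y - 0) * z' s" using mono[of s] s by simp
  then show False using s y init by linarith
qed

text \<open>
  The two-sided form for a zero initial slope; the upper bound on \<open>P\<close> provides a positive function
  satisfying the same inequality, which is added when the initial value is zero. Reflection carries the half line to the whole line.
\<close>
lemma nonneg_of_second_derivative_ge:
  fixes z z' z'' P :: "real \<Rightarrow> real"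
  assumes z: "\<And>x. (z has_real_derivative z' x) (at x)"
    and z': "\<And>x. (z' has_real_derivative z'' x) (at x)"
    and ge: "\<And>x. P x * z x \<le> z'' x"
    and P: "\<And>x. 0 \<le> P x" "\<And>x. P x \<le> k"
    and init: "0 \<le> z 0" "z' 0 = 0"
  shows "0 \<le> z x"
proof -
  have half: "0 \<le> y x"
    if y: "\<And>x. (y has_real_derivative y' x) (at x)"
      and y': "\<And>x. (y' has_real_derivative y'' x) (at x)"
      and ge: "\<And>x. Q x * y x \<le> y'' x"
      and Q: "\<And>x. 0 \<le> Q x" "\<And>x. Q x \<le> k"
      and init: "0 \<le> y 0" "y' 0 = 0" and x: "0 \<le> x"
    for y y' y'' Q :: "real \<Rightarrow> real" and x
  proof (rule ccontr)
    assume neg: "\<not> 0 \<le> y x"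
    define q where "q = sqrt k"
    have "0 \<le> k" using Q[of 0] by linarith
    then have q: "q * q = k" by (simp add: q_def)
    \<comment> \<open>The multiple of \<open>cosh (q x)\<close> satisfies the same differential inequality because \<open>Q \<le> q\<^sup>2\<close>. It makes
      the initial value positive and is small enough to leave the value at \<open>x\<close> negative.\<close>
    define e where "e = - y x / (2 * cosh (q * x))"
    have "0 < e" using neg by (simp add: e_def divide_neg_pos)
    have "0 < y x + e * cosh (q * x)"
    proof (rule pos_of_second_derivative_ge_halfline
        [where z = "\<lambda>x. y x + e * cosh (q * x)" and x = x
           and z' = "\<lambda>x. y' x + e * (q * sinh (q * x))"
           and z'' = "\<lambda>x. y'' x + e * (k * cosh (q * x))" and P = Q, OF _ _ _ _ _ _ x])
      fix x :: real
      show "((\<lambda>x. y x + e * cosh (q * x)) has_real_derivative y' x + e * (q * sinh (q * x))) (at x)"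
        by (auto intro!: derivative_eq_intros y)
      show "((\<lambda>x. y' x + e * (q * sinh (q * x))) has_real_derivative
              y'' x + e * (k * cosh (q * x))) (at x)"
        by (auto intro!: derivative_eq_intros y' simp: q[symmetric])
      have "Q x * (e * cosh (q * x)) \<le> k * (e * cosh (q * x))"
        using Q(2)[of x] \<open>0 < e\<close> by (intro mult_right_mono) auto
      then show "Q x * (y x + e * cosh (q * x)) \<le> y'' x + e * (k * cosh (q * x))"
        using ge[of x] by (simp add: algebra_simps)
    qed (use Q init \<open>0 < e\<close> in auto)
    then show False using neg by (simp add: e_def)
  qed
  show ?thesis
  proof (cases "0 \<le> x")
    case True
    show ?thesis by (rule half[OF z z' ge P init True])
  next
    case False
    have "0 \<le> z (- (- x))"
    proof (rule half[where y = "\<lambda>x. z (- x)" and y' = "\<lambda>x. - z' (- x)" and y'' = "\<lambda>x. z'' (- x)"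
          and Q = "\<lambda>x. P (- x)"])
      fix x
      show "((\<lambda>x. z (- x)) has_real_derivative - z' (- x)) (at x)"
        using DERIV_chain2[OF z, of uminus "-1" x UNIV] by (simp add: DERIV_minus[OF DERIV_ident])
      show "((\<lambda>x. - z' (- x)) has_real_derivative z'' (- x)) (at x)"
        using DERIV_minus[OF DERIV_chain2[OF z', of uminus "-1" x UNIV]]
        by (simp add: DERIV_minus[OF DERIV_ident])
    qed (use ge P init False in auto)
    then show ?thesis by simp
  qed
qed

text \<open>
  The working tool of the whole proof. Since \<open>k < \<mu>\<^sup>2\<close>, a multiple of \<open>cosh (\<mu> x)\<close> absorbs both the
  coefficient \<open>P\<close> and the forcing, so it dominates \<open>\<plusminus>y\<close> by the previous lemma. The bound
  depends on \<open>P\<close> only through \<open>k\<close>, which is what makes all later constants uniform.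
\<close>
lemma cosh_bound_of_linear_ode:
  fixes y y' y'' P :: "real \<Rightarrow> real"
  assumes y: "\<And>x. (y has_real_derivative y' x) (at x)"
    and y': "\<And>x. (y' has_real_derivative y'' x) (at x)"
    and F: "\<And>x. \<bar>y'' x - P x * y x\<bar> \<le> A * cosh (\<mu> * x)"
    and P: "\<And>x. 0 \<le> P x" "\<And>x. P x \<le> k"
    and \<mu>: "k < \<mu>\<^sup>2"
    and init: "\<bar>y 0\<bar> \<le> B" "y' 0 = 0"
  shows "\<bar>y x\<bar> \<le> (B + A / (\<mu>\<^sup>2 - k)) * cosh (\<mu> * x)"
proof -
  have A: "0 \<le> A" using F[of 0] by simp
  define K where "K = B + A / (\<mu>\<^sup>2 - k)"
  have AK: "A / (\<mu>\<^sup>2 - k) \<le> K" using init by (simp add: K_def)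
  have K0: "0 \<le> K" using AK A \<mu> using divide_nonneg_pos[of A "\<mu>\<^sup>2 - k"] by linarith
  have AK': "A \<le> K * (\<mu>\<^sup>2 - k)" using AK \<mu> by (simp add: divide_le_eq)
  have BK: "B \<le> K" using A \<mu> by (simp add: K_def)
  have key: "0 \<le> K * cosh (\<mu> * x) + s * y x" if s: "s = 1 \<or> s = -1" for s :: real and x
  proof (rule nonneg_of_second_derivative_ge
      [where z = "\<lambda>x. K * cosh (\<mu> * x) + s * y x" and x = x
        and z' = "\<lambda>x. K * (\<mu> * sinh (\<mu> * x)) + s * y' x"
        and z'' = "\<lambda>x. K * (\<mu>\<^sup>2 * cosh (\<mu> * x)) + s * y'' x" and P = P and k = k])
    fix x :: real
    show "((\<lambda>x. K * cosh (\<mu> * x) + s * y x) has_real_derivative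
            K * (\<mu> * sinh (\<mu> * x)) + s * y' x) (at x)"
      by (auto intro!: derivative_eq_intros y)
    show "((\<lambda>x. K * (\<mu> * sinh (\<mu> * x)) + s * y' x) has_real_derivative
            K * (\<mu>\<^sup>2 * cosh (\<mu> * x)) + s * y'' x) (at x)"
      by (auto intro!: derivative_eq_intros y' simp: power2_eq_square)
    have "P x * (K * cosh (\<mu> * x)) + A * cosh (\<mu> * x)
        \<le> k * (K * cosh (\<mu> * x)) + (K * (\<mu>\<^sup>2 - k)) * cosh (\<mu> * x)"
      using P(2)[of x] K0 AK' by (intro add_mono mult_right_mono) auto
    also have "\<dots> = K * (\<mu>\<^sup>2 * cosh (\<mu> * x))" by (simp add: algebra_simps)
    finally show "P x * (K * cosh (\<mu> * x) + s * y x) \<le> K * (\<mu>\<^sup>2 * cosh (\<mu> * x)) + s * y'' x"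
      using s F[of x] by (auto simp: algebra_simps abs_le_iff)
  qed (use P init BK s in \<open>auto simp: abs_le_iff\<close>)
  from key[of 1 x] key[of "-1" x] show ?thesis by (auto simp: K_def[symmetric] abs_le_iff)
qed

section \<open>The energy of a square integrable profile vanishes\<close>

text \<open>
  Barbalat's argument: a large value at \<open>x\<close> persists on an interval of fixed length to the right of
  \<open>x\<close>, but the integral over \<open>[x, \<infinity>)\<close> tends to zero.
\<close>
lemma integrable_lipschitz_tendsto_zero:
  fixes f :: "real \<Rightarrow> real"
  assumes int: "integrable lborel f" and nonneg: "\<And>x. 0 \<le> f x"
    and lip: "\<And>x y. \<bar>f x - f y\<bar> \<le> K * \<bar>x - y\<bar>"
  shows "(f \<longlongrightarrow> 0) at_top"
proof -
  define T where "T n = (LINT x|lborel. indicator {real n..} x * f x)" for n :: nat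
  have K: "0 \<le> K" using lip[of 1 0] by simp
  have int': "integrable lborel (\<lambda>x. indicator {t..} x * f x)" for t
    using integrable_real_mult_indicator[OF _ int, of "{t..}"] by (simp add: mult.commute)
  have "(\<lambda>n. T n) \<longlonglongrightarrow> (LINT x::real|lborel. (0::real))"
    unfolding T_def
  proof (rule integral_dominated_convergence[where w = "\<lambda>x. \<bar>f x\<bar>" and f = "\<lambda>x. 0"
        and s = "\<lambda>n x. indicator {real n..} x * f x"])
    show "AE x in lborel. (\<lambda>i. indicator {real i..} x * f x) \<longlonglongrightarrow> 0"
    proof (rule AE_I2)
      fix x :: real
      obtain N :: nat where "x < real N" using reals_Archimedean2 by blast
      then show "(\<lambda>i. indicator {real i..} x * f x) \<longlonglongrightarrow> 0"
        by (intro tendsto_eventually eventually_sequentiallyI[of N]) (auto simp: indicator_def)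
    qed
  qed (use int' int in \<open>auto simp: indicator_def borel_measurable_integrable intro!: integrable_abs\<close>)
  then have T: "T \<longlonglongrightarrow> 0" by simp
  show ?thesis
  proof (rule tendstoI)
    fix e :: real assume "0 < e"
    \<comment> \<open>On an interval of length \<open>d\<close> the function varies by less than \<open>e / 2\<close>.\<close>
    define d where "d = e / (2 * (K + 1))"
    have "0 < d" using \<open>0 < e\<close> K by (simp add: d_def)
    have Kd: "K * d < e / 2" using \<open>0 < e\<close> K by (simp add: d_def field_simps)
    have "0 < d * (e / 2)" using \<open>0 < e\<close> \<open>0 < d\<close> by simp
    from order_tendstoD(2)[OF T this] obtain N where N: "T N < d * (e / 2)"
      by (auto simp: eventually_sequentially)
    have "f x < e" if "real N \<le> x" for x
    proof -
      have intd: "integrable lborel (\<lambda>y. indicator {x..x+d} y * C)" for C :: real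
        by (intro integrable_mult_left integrable_real_indicator) (auto simp: emeasure_lborel_Icc_eq)
      have "d * f x = (LINT y|lborel. indicator {x..x+d} y * f x)"
        using \<open>0 < d\<close> by simp
      also have "\<dots> \<le> (LINT y|lborel. indicator {real N..} y * f y + indicator {x..x+d} y * (K * d))"
      proof (rule integral_mono)
        fix y :: real
        have "f x \<le> f y + K * d" if "y \<in> {x..x+d}"
        proof -
          have "\<bar>f x - f y\<bar> \<le> K * \<bar>x - y\<bar>" by (rule lip)
          also have "\<dots> \<le> K * d" using that K by (intro mult_left_mono) auto
          finally show ?thesis by simp
        qed
        then show "indicator {x..x+d} y * f x
            \<le> indicator {real N..} y * f y + indicator {x..x+d} y * (K * d)"
          using \<open>real N \<le> x\<close> nonneg[of y] K \<open>0 < d\<close> by (auto simp: indicator_def)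
      qed (intro intd int' Bochner_Integration.integrable_add)+
      also have "\<dots> = T N + d * (K * d)"
        unfolding T_def using \<open>0 < d\<close>
        by (subst Bochner_Integration.integral_add[OF int' intd]) simp
      also have "\<dots> < d * (e / 2) + d * (e / 2)"
        using N Kd \<open>0 < d\<close> by (intro add_strict_mono mult_strict_left_mono) auto
      finally show ?thesis using \<open>0 < d\<close> by (simp add: distrib_left[symmetric])
    qed
    then have "\<And>x. real N \<le> x \<Longrightarrow> dist (f x) 0 < e" using nonneg by (simp add: dist_real_def)
    then show "\<forall>\<^sub>F x in at_top. dist (f x) 0 < e"
      by (rule eventually_at_top_linorderI)
  qed
qed

text \<open>
  Multiplying the profile equation by \<open>\<psi>'\<close> gives the conserved energy
  \<open>\<psi>'\<^sup>2 - a \<psi>\<^sup>2 - c \<psi>^4 / 4 + \<psi>^6 / 16 + 2 b \<psi>^(p+2) / (p+2)\<close>.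
  Because of its sextic term the conservation law bounds \<open>\<psi>\<close> and then \<open>\<psi>'\<close>, so \<open>\<psi>\<^sup>2\<close> is Lipschitz and
  integrable and \<open>\<psi>\<close> tends to zero. Now \<open>\<psi>'\<^sup>2\<close> converges to the energy, while the mean value theorem
  on \<open>[n, n+1]\<close> yields points where \<open>\<psi>'\<close> tends to zero.
\<close>
lemma profile_first_integral:
  fixes \<psi> \<psi>' :: "real \<Rightarrow> real"
  assumes p: "4 \<le> p" and b: "0 \<le> b"
    and pos: "\<And>x. 0 < \<psi> x"
    and \<psi>: "\<And>x. (\<psi> has_real_derivative \<psi>' x) (at x)"
    and \<psi>': "\<And>x. (\<psi>' has_real_derivative
        a * \<psi> x + c / 2 * \<psi> x ^ 3 - 3 / 16 * \<psi> x ^ 5 - b * \<psi> x powr (p + 1)) (at x)"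
    and int: "integrable lborel (\<lambda>x. (\<psi> x)\<^sup>2)"
  shows "(\<psi>' x)\<^sup>2 = a * \<psi> x ^ 2 + c / 4 * \<psi> x ^ 4 - \<psi> x ^ 6 / 16 - 2 * b / (p + 2) * \<psi> x powr (p + 2)"
proof -
  define G where "G y = a * y ^ 2 + c / 4 * y ^ 4 - y ^ 6 / 16 - 2 * b / (p + 2) * y powr (p + 2)" for y
  define E where "E = (\<psi>' 0)\<^sup>2 - G (\<psi> 0)"
  have E: "(\<psi>' x)\<^sup>2 = E + G (\<psi> x)" for x
  proof -
    have "((\<lambda>x. (\<psi>' x)\<^sup>2 - G (\<psi> x)) has_real_derivative 0) (at x)" for x
    proof -
      define \<beta> where "\<beta> = 2 * b / (p + 2)"
      have \<beta>: "\<beta> * (p + 2) = 2 * b" using p by (simp add: \<beta>_def)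
      have d: "((\<lambda>x. \<psi> x powr (p + 2)) has_real_derivative (p + 2) * \<psi> x powr (p + 1) * \<psi>' x) (at x)"
        using DERIV_fun_powr[OF \<psi> pos, where r = "p + 2" and x = x] by (simp add: add.commute)
      have "((\<lambda>x. (\<psi>' x)\<^sup>2 - (a * \<psi> x ^ 2 + c / 4 * \<psi> x ^ 4 - \<psi> x ^ 6 / 16
          - \<beta> * \<psi> x powr (p + 2))) has_real_derivative
          2 * \<psi>' x * (a * \<psi> x + c / 2 * \<psi> x ^ 3 - 3 / 16 * \<psi> x ^ 5 - b * \<psi> x powr (p + 1))
          - (a * (2 * \<psi> x * \<psi>' x) + c / 4 * (4 * \<psi> x ^ 3 * \<psi>' x) - (6 * \<psi> x ^ 5 * \<psi>' x) / 16
          - \<beta> * ((p + 2) * \<psi> x powr (p + 1) * \<psi>' x))) (at x)"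
        by (rule derivative_eq_intros d \<psi> \<psi>' refl | simp)+
      moreover have "\<beta> * ((p + 2) * \<psi> x powr (p + 1) * \<psi>' x) = 2 * b * \<psi> x powr (p + 1) * \<psi>' x"
        by (simp only: mult.assoc[symmetric] \<beta>)
      ultimately show ?thesis unfolding G_def \<beta>_def[symmetric] by (simp add: algebra_simps)
    qed
    then have "(\<psi>' x)\<^sup>2 - G (\<psi> x) = (\<psi>' 0)\<^sup>2 - G (\<psi> 0)" by (intro DERIV_isconst_all allI)
    then show ?thesis by (simp add: E_def)
  qed
  have G_le: "G y \<le> a * y\<^sup>2 + c / 4 * (y\<^sup>2)\<^sup>2 - (y\<^sup>2)^3 / 16" for y
    using p b by (simp add: G_def power_mult[symmetric])
  \<comment> \<open>Beyond \<open>B\<close> the term \<open>\<psi>^6 / 16\<close> outweighs the rest of the energy, and \<open>\<psi>'\<^sup>2\<close> would be negative.\<close>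
  define B where "B = 1 + 16 * (\<bar>E\<bar> + \<bar>a\<bar> + \<bar>c\<bar>)"
  have B1: "1 \<le> B" by (simp add: B_def)
  have B: "(\<psi> x)\<^sup>2 \<le> B" for x
  proof (rule ccontr)
    define s where "s = (\<psi> x)\<^sup>2"
    assume "\<not> (\<psi> x)\<^sup>2 \<le> B"
    then have s: "B < s" by (simp add: s_def)
    then have "1 \<le> s" using B1 by linarith
    then have s1: "1 \<le> s\<^sup>2" and s2: "s \<le> s\<^sup>2"
      using one_le_power[of s 2] mult_left_mono[of 1 s s] by (auto simp: power2_eq_square)
    have "s^3 / 16 \<le> E + a * s + c / 4 * s\<^sup>2"
      using G_le[of "\<psi> x"] E[of x] zero_le_power2[of "\<psi>' x"] unfolding s_def by linarith
    also have "\<dots> \<le> \<bar>E\<bar> * s\<^sup>2 + \<bar>a\<bar> * s\<^sup>2 + \<bar>c\<bar> * s\<^sup>2"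
    proof (intro add_mono)
      show "E \<le> \<bar>E\<bar> * s\<^sup>2" using mult_left_mono[OF s1, of "\<bar>E\<bar>"] by linarith
      show "a * s \<le> \<bar>a\<bar> * s\<^sup>2" using s2 \<open>1 \<le> s\<close> by (intro mult_mono) auto
      show "c / 4 * s\<^sup>2 \<le> \<bar>c\<bar> * s\<^sup>2" by (intro mult_right_mono) auto
    qed
    also have "\<dots> = (\<bar>E\<bar> + \<bar>a\<bar> + \<bar>c\<bar>) * s\<^sup>2" by (simp add: algebra_simps)
    finally have "s * s\<^sup>2 \<le> (16 * (\<bar>E\<bar> + \<bar>a\<bar> + \<bar>c\<bar>)) * s\<^sup>2"
      unfolding power3_eq_cube power2_eq_square mult.assoc[of s s s] by linarith
    then have "s \<le> 16 * (\<bar>E\<bar> + \<bar>a\<bar> + \<bar>c\<bar>)" using \<open>1 \<le> s\<close> by (simp add: mult_le_cancel_right)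
    then show False using s by (simp add: B_def)
  qed
  define K where "K = B + (\<bar>E\<bar> + \<bar>a\<bar> * B + \<bar>c\<bar> * B\<^sup>2)"
  have \<psi>'_le: "(\<psi>' x)\<^sup>2 \<le> \<bar>E\<bar> + \<bar>a\<bar> * B + \<bar>c\<bar> * B\<^sup>2" for x
  proof -
    have "(\<psi>' x)\<^sup>2 \<le> E + a * (\<psi> x)\<^sup>2 + c / 4 * ((\<psi> x)\<^sup>2)\<^sup>2"
      using G_le[of "\<psi> x"] E[of x] zero_le_power[OF zero_le_power2, of "\<psi> x" 3] by linarith
    also have "\<dots> \<le> \<bar>E\<bar> + \<bar>a\<bar> * B + \<bar>c\<bar> * B\<^sup>2"
      using B[of x] by (intro add_mono mult_mono power_mono) auto
    finally show ?thesis .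
  qed
  have lip: "\<bar>(\<psi> x)\<^sup>2 - (\<psi> y)\<^sup>2\<bar> \<le> K * \<bar>x - y\<bar>" for x y
  proof -
    have "norm ((\<psi> x)\<^sup>2 - (\<psi> y)\<^sup>2) \<le> K * norm (x - y)"
    proof (rule field_differentiable_bound[where S = UNIV and f' = "\<lambda>x. 2 * \<psi> x * \<psi>' x"])
      fix x
      show "((\<lambda>x. (\<psi> x)\<^sup>2) has_real_derivative 2 * \<psi> x * \<psi>' x) (at x within UNIV)"
        by (auto intro!: derivative_eq_intros \<psi>)
      have "\<bar>2 * \<psi> x * \<psi>' x\<bar> \<le> (\<psi> x)\<^sup>2 + (\<psi>' x)\<^sup>2"
        using sum_squares_bound[of "\<bar>\<psi> x\<bar>" "\<bar>\<psi>' x\<bar>"] by (simp add: abs_mult)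
      then show "norm (2 * \<psi> x * \<psi>' x) \<le> K"
        using \<psi>'_le[of x] B[of x] by (simp add: K_def)
    qed auto
    then show ?thesis by simp
  qed
  have "((\<lambda>x. (\<psi> x)\<^sup>2) \<longlongrightarrow> 0) at_top"
    by (rule integrable_lipschitz_tendsto_zero[OF int _ lip]) simp
  then have "((\<lambda>x. sqrt ((\<psi> x)\<^sup>2)) \<longlongrightarrow> sqrt 0) at_top" by (rule tendsto_real_sqrt)
  then have lim: "(\<psi> \<longlongrightarrow> 0) at_top" using pos by (simp add: less_imp_le)
  have "((\<lambda>x. \<psi> x powr (p + 2)) \<longlongrightarrow> 0 powr (p + 2)) at_top"
    using p pos by (intro tendsto_powr' lim tendsto_const) (auto simp: less_imp_le)
  then have "((\<lambda>x. E + G (\<psi> x)) \<longlongrightarrow> E + (a * 0 ^ 2 + c / 4 * 0 ^ 4 - 0 ^ 6 / 16 - 2 * b / (p + 2) * 0)) at_top"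
    unfolding G_def by (intro tendsto_intros lim) auto
  then have limE: "((\<lambda>x. (\<psi>' x)\<^sup>2) \<longlongrightarrow> E) at_top" by (simp add: E)
  have "\<exists>s. real n < s \<and> s < real n + 1 \<and> \<psi> (real n + 1) - \<psi> (real n) = \<psi>' s" for n :: nat
    using MVT2[of "real n" "real n + 1" \<psi> \<psi>'] \<psi> by fastforce
  then obtain s where s: "\<And>n. real n < s n" "\<And>n. \<psi> (real n + 1) - \<psi> (real n) = \<psi>' (s n)"
    by metis
  have "filterlim s at_top sequentially"
    by (rule filterlim_at_top_mono[OF filterlim_real_sequentially]) (use s in \<open>auto simp: less_imp_le\<close>)
  then have l1: "(\<lambda>n. (\<psi>' (s n))\<^sup>2) \<longlonglongrightarrow> E"
    by (rule filterlim_compose[OF limE])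
  have "filterlim (\<lambda>n. real n + 1) at_top sequentially"
    by (rule filterlim_at_top_mono[OF filterlim_real_sequentially]) simp
  then have "(\<lambda>n. (\<psi> (real n + 1) - \<psi> (real n))\<^sup>2) \<longlonglongrightarrow> (0 - 0)\<^sup>2"
    by (intro tendsto_power tendsto_diff filterlim_compose[OF lim] filterlim_real_sequentially)
  then have "(\<lambda>n. (\<psi>' (s n))\<^sup>2) \<longlonglongrightarrow> 0" by (simp add: s(2))
  then have "E = 0" using l1 LIMSEQ_unique by blast
  then show ?thesis using E[of x] by (simp add: G_def)
qed

section \<open>The reciprocal square of a profile\<close>
lemma inverse_square_powr:
  fixes y s :: real
  assumes "0 < y"
  shows "(1 / y\<^sup>2) powr (- (s / 2)) = y powr s"
proof -
  have "1 / y\<^sup>2 = y powr (- 2)" using assms by (simp add: powr_minus_divide)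
  then show ?thesis by (simp add: powr_powr)
qed

text \<open>
  The equation satisfied by \<open>u = 1 / \<phi>\<^sup>2\<close>. It is linear apart from the term of order \<open>b\<close>. The last
  conjunct is the vanishing energy at the origin, where \<open>\<phi>' = 0\<close>, divided by \<open>\<phi>^6\<close>; it determines
  \<open>u 0\<close>.
\<close>
definition reciprocal_profile :: "real \<Rightarrow> real \<Rightarrow> real \<Rightarrow> real \<Rightarrow> (real \<Rightarrow> real) \<Rightarrow> bool" where
  "reciprocal_profile p b a c u \<longleftrightarrow>
     (\<forall>x. 0 < u x) \<and>
     (\<exists>u'. u' 0 = 0 \<and> (\<forall>x. (u has_real_derivative u' x) (at x) \<and>
        (u' has_real_derivative
          4 * a * u x + c / 2 + b * (2 * (p - 4) / (p + 2)) * u x powr (- ((p - 2) / 2))) (at x))) \<and>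
     a * (u 0)\<^sup>2 + c / 4 * u 0 - 1 / 16 - 2 * b / (p + 2) * u 0 powr (- ((p - 4) / 2)) = 0"

text \<open>
  In \<open>u'' = 6 \<phi>'\<^sup>2 / \<phi>^4 - 2 \<phi>'' / \<phi>^3\<close> the first integral replaces \<open>\<phi>'\<^sup>2\<close> and the equation replaces
  \<open>\<phi>''\<close>. The quintic nonlinearity cancels, the cubic one turns into the constant \<open>c / 2\<close>, and only
  the power \<open>p\<close> leaves a nonlinear term.
\<close>
lemma reciprocal_profile_of_profile:
  assumes p: "4 \<le> p" and b: "0 \<le> b" and prof: "is_profile p b \<omega> c \<phi>"
  shows "reciprocal_profile p b (\<omega> - c\<^sup>2 / 4) c (\<lambda>x. 1 / (\<phi> x)\<^sup>2)"
proof -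
  define a where "a = \<omega> - c\<^sup>2 / 4"
  define \<phi>' where "\<phi>' = deriv \<phi>"
  have pos: "0 < \<phi> x" for x using prof by (simp add: is_profile_def)
  have even: "\<phi> (- x) = \<phi> x" for x using prof by (simp add: is_profile_def)
  have sol: "\<phi> field_differentiable (at x)" "\<phi>' field_differentiable (at x)"
      "- deriv \<phi>' x + a * \<phi> x + c / 2 * \<bar>\<phi> x\<bar>^2 * \<phi> x
          - 3 / 16 * \<bar>\<phi> x\<bar>^4 * \<phi> x - b * \<bar>\<phi> x\<bar> powr p * \<phi> x = 0" for x
    using prof by (auto simp: is_profile_def solves_profile_eq_def \<phi>'_def a_def)
  have d1: "(\<phi> has_real_derivative \<phi>' x) (at x)" for x
    using sol(1) by (simp add: \<phi>'_def field_differentiable_derivI)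
  have d2: "(\<phi>' has_real_derivative
      a * \<phi> x + c / 2 * \<phi> x ^ 3 - 3 / 16 * \<phi> x ^ 5 - b * \<phi> x powr (p + 1)) (at x)" for x
  proof -
    have "deriv \<phi>' x = a * \<phi> x + c / 2 * \<phi> x ^ 3 - 3 / 16 * \<phi> x ^ 5 - b * \<phi> x powr (p + 1)"
      using sol(3)[of x] pos[of x] by (simp add: powr_add eval_nat_numeral algebra_simps)
    then show ?thesis using sol(2)[of x] by (metis field_differentiable_derivI)
  qed
  have int: "integrable lborel (\<lambda>x. (\<phi> x)\<^sup>2)"
    using prof by (simp add: is_profile_def H1_def L2_def)
  note energy = profile_first_integral[OF p b pos d1 d2 int]
  have \<phi>'0: "\<phi>' 0 = 0"
  proof -
    have "((\<lambda>x. \<phi> (- x)) has_real_derivative - \<phi>' 0) (at 0)"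
      using DERIV_chain2[OF d1, of uminus "-1" 0 UNIV] by (simp add: DERIV_minus[OF DERIV_ident])
    then have "(\<phi> has_real_derivative - \<phi>' 0) (at 0)" by (simp add: even)
    from DERIV_unique[OF d1[of 0] this] show ?thesis by linarith
  qed
  show ?thesis
    unfolding reciprocal_profile_def a_def[symmetric]
  proof (intro conjI allI exI[where x = "\<lambda>x. - 2 * \<phi>' x / (\<phi> x) ^ 3"])
    fix x
    have p0: "\<phi> x \<noteq> 0" using pos[of x] by simp
    show "0 < 1 / (\<phi> x)\<^sup>2" using pos[of x] by simp
    show "((\<lambda>x. 1 / (\<phi> x)\<^sup>2) has_real_derivative - 2 * \<phi>' x / \<phi> x ^ 3) (at x)"
      using p0 by (auto intro!: derivative_eq_intros d1 simp: field_simps eval_nat_numeral)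
    have pw: "(1 / (\<phi> x)\<^sup>2) powr (- ((p - 2) / 2)) = \<phi> x powr (p - 2)"
      by (rule inverse_square_powr[OF pos])
    have e1: "\<phi> x powr (p + 1) = \<phi> x powr (p - 2) * \<phi> x ^ 3"
      and e2: "\<phi> x powr (p + 2) = \<phi> x powr (p - 2) * \<phi> x ^ 4"
      using pos[of x] by (simp_all add: powr_add[symmetric] add.commute flip: powr_numeral)
    define t where "t = \<phi> x powr (p - 2)"
    have "((\<lambda>x. - 2 * \<phi>' x / \<phi> x ^ 3) has_real_derivative
        6 * (\<phi>' x)\<^sup>2 / \<phi> x ^ 4 - 2 * (a * \<phi> x + c / 2 * \<phi> x ^ 3 - 3 / 16 * \<phi> x ^ 5 - b * \<phi> x powr (p + 1)) / \<phi> x ^ 3) (at x)"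
      using p0 by (auto intro!: derivative_eq_intros d1 d2 simp: field_simps eval_nat_numeral)
    moreover have "6 * (\<phi>' x)\<^sup>2 / \<phi> x ^ 4 - 2 * (a * \<phi> x + c / 2 * \<phi> x ^ 3 - 3 / 16 * \<phi> x ^ 5 - b * \<phi> x powr (p + 1)) / \<phi> x ^ 3
       = 4 * a * (1 / (\<phi> x)\<^sup>2) + c / 2 + b * (2 * (p - 4) / (p + 2)) * (1 / (\<phi> x)\<^sup>2) powr (- ((p - 2) / 2))"
      unfolding energy pw e1 e2 t_def[symmetric] using p0 p
      by (simp add: divide_simps) (simp add: algebra_simps eval_nat_numeral)
    ultimately show "((\<lambda>x. - 2 * \<phi>' x / \<phi> x ^ 3) has_real_derivative
        4 * a * (1 / (\<phi> x)\<^sup>2) + c / 2 + b * (2 * (p - 4) / (p + 2)) * (1 / (\<phi> x)\<^sup>2) powr (- ((p - 2) / 2))) (at x)"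
      by simp
  next
    define y where "y = \<phi> 0"
    have y: "0 < y" using pos by (simp add: y_def)
    have pw: "(1 / y\<^sup>2) powr (- ((p - 4) / 2)) = y powr (p - 4)"
      by (rule inverse_square_powr[OF y])
    have e: "y powr (p + 2) = y powr (p - 4) * y ^ 6"
      using y by (simp_all add: powr_add[symmetric] add.commute flip: powr_numeral)
    have "0 = a * y ^ 2 + c / 4 * y ^ 4 - y ^ 6 / 16 - 2 * b / (p + 2) * (y powr (p - 4) * y ^ 6)"
      using energy[of 0] by (simp add: \<phi>'0 y_def[symmetric] e)
    also have "\<dots> = y ^ 6 * (a * (1 / y\<^sup>2)\<^sup>2 + c / 4 * (1 / y\<^sup>2) - 1 / 16 - 2 * b / (p + 2) * y powr (p - 4))"
      using y by (simp add: field_simps eval_nat_numeral)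
    finally show "a * (1 / (\<phi> 0)\<^sup>2)\<^sup>2 + c / 4 * (1 / (\<phi> 0)\<^sup>2) - 1 / 16
        - 2 * b / (p + 2) * (1 / (\<phi> 0)\<^sup>2) powr (- ((p - 4) / 2)) = 0"
      using y by (simp add: y_def[symmetric] pw)
  qed (simp add: \<phi>'0)
qed

section \<open>Elementary estimates\<close>
lemma abs_add_bound: "\<bar>x + y\<bar> \<le> s + t" if "\<bar>x\<bar> \<le> s" "\<bar>y\<bar> \<le> t" for x y s t :: real
  using that by linarith

lemma abs_diff_bound: "\<bar>x - y\<bar> \<le> s + t" if "\<bar>x\<bar> \<le> s" "\<bar>y\<bar> \<le> t" for x y s t :: real
  using that by linarith

lemma powr_neg_mvt:
  fixes x y s l :: real
  assumes "0 < l" "l \<le> x" "l \<le> y"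
  shows "\<exists>\<xi>. l \<le> \<xi> \<and> \<bar>\<xi> - y\<bar> \<le> \<bar>x - y\<bar> \<and>
      x powr (- s) - y powr (- s) = - (s * \<xi> powr (- s - 1)) * (x - y)"
proof -
  have d: "((\<lambda>t. t powr (- s)) has_real_derivative - (s * t powr (- s - 1))) (at t)" if "l \<le> t" for t
    using has_real_derivative_powr[of t "- s"] that assms by simp
  consider "x = y" | "x < y" | "y < x" by linarith
  then show ?thesis
  proof cases
    case 1
    then show ?thesis using assms by (intro exI[of _ y]) auto
  next
    case 2
    obtain t where t: "x < t" "t < y" "y powr (- s) - x powr (- s) = (y - x) * (- (s * t powr (- s - 1)))"
      using MVT2[OF 2, of "\<lambda>t. t powr (- s)" "\<lambda>t. - (s * t powr (- s - 1))"] d assms by auto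
    show ?thesis using t assms by (intro exI[of _ t]) (auto simp: algebra_simps)
  next
    case 3
    obtain t where t: "y < t" "t < x" "x powr (- s) - y powr (- s) = (x - y) * (- (s * t powr (- s - 1)))"
      using MVT2[OF 3, of "\<lambda>t. t powr (- s)" "\<lambda>t. - (s * t powr (- s - 1))"] d assms by auto
    show ?thesis using t assms by (intro exI[of _ t]) (auto simp: algebra_simps)
  qed
qed

lemma powr_neg_lipschitz:
  fixes x y s l :: real
  assumes "0 \<le> s" "0 < l" "l \<le> x" "l \<le> y"
  shows "\<bar>x powr (- s) - y powr (- s)\<bar> \<le> s * l powr (- s - 1) * \<bar>x - y\<bar>"
proof -
  obtain t where t: "l \<le> t" "x powr (- s) - y powr (- s) = - (s * t powr (- s - 1)) * (x - y)"
    using powr_neg_mvt[of l x y s] assms by auto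
  have "t powr (- s - 1) \<le> l powr (- s - 1)" using t assms by (intro powr_mono2') auto
  then show ?thesis
    unfolding t(2) using assms by (simp add: abs_mult mult_left_mono mult_right_mono)
qed

lemma powr_neg_taylor:
  fixes x y s l :: real
  assumes "0 \<le> s" "0 < l" "l \<le> x" "l \<le> y"
  shows "\<bar>x powr (- s) - y powr (- s) + s * y powr (- s - 1) * (x - y)\<bar>
      \<le> s * (s + 1) * l powr (- s - 2) * (x - y)\<^sup>2"
proof -
  obtain t where t: "l \<le> t" "\<bar>t - y\<bar> \<le> \<bar>x - y\<bar>"
      "x powr (- s) - y powr (- s) = - (s * t powr (- s - 1)) * (x - y)"
    using powr_neg_mvt[of l x y s] assms by auto
  have e1: "- (s + 1) - 1 = - s - 2" and e2: "- (s + 1) = - s - 1" by simp_all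
  have "\<bar>t powr (- s - 1) - y powr (- s - 1)\<bar> \<le> (s + 1) * l powr (- s - 2) * \<bar>t - y\<bar>"
    using powr_neg_lipschitz[of "s + 1" l t y, unfolded e1, unfolded e2] t assms by simp
  also have "\<dots> \<le> (s + 1) * l powr (- s - 2) * \<bar>x - y\<bar>"
    using t assms by (intro mult_left_mono) auto
  finally have *: "\<bar>t powr (- s - 1) - y powr (- s - 1)\<bar> \<le> (s + 1) * l powr (- s - 2) * \<bar>x - y\<bar>" .
  have "\<bar>x powr (- s) - y powr (- s) + s * y powr (- s - 1) * (x - y)\<bar>
      = s * \<bar>t powr (- s - 1) - y powr (- s - 1)\<bar> * \<bar>x - y\<bar>"
  proof -
    have "x powr (- s) - y powr (- s) + s * y powr (- s - 1) * (x - y)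
        = - (s * (t powr (- s - 1) - y powr (- s - 1)) * (x - y))"
      unfolding t(3) by (simp add: algebra_simps)
    then show ?thesis using assms by (simp add: abs_mult)
  qed
  also have "\<dots> \<le> s * ((s + 1) * l powr (- s - 2) * \<bar>x - y\<bar>) * \<bar>x - y\<bar>"
    using * assms by (intro mult_right_mono mult_left_mono) auto
  also have "\<dots> = s * (s + 1) * l powr (- s - 2) * (x - y)\<^sup>2"
    by (simp add: power2_eq_square mult.assoc flip: abs_mult)
  finally show ?thesis .
qed

section \<open>Exponential growth of the reciprocal profile\<close>
lemma sqrt_minus_mult_plus:
  fixes a c :: real
  assumes "0 < a"
  shows "(sqrt (c\<^sup>2 + 4 * a) - \<bar>c\<bar>) * (sqrt (c\<^sup>2 + 4 * a) + \<bar>c\<bar>) = 4 * a"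
    and "\<bar>c\<bar> < sqrt (c\<^sup>2 + 4 * a)"
proof -
  have "(sqrt (c\<^sup>2 + 4 * a))\<^sup>2 = c\<^sup>2 + 4 * a"
    using assms by (intro real_sqrt_pow2) (auto intro: add_nonneg_nonneg)
  then show "(sqrt (c\<^sup>2 + 4 * a) - \<bar>c\<bar>) * (sqrt (c\<^sup>2 + 4 * a) + \<bar>c\<bar>) = 4 * a"
    by (simp add: algebra_simps power2_eq_square)
  have "sqrt (c\<^sup>2) < sqrt (c\<^sup>2 + 4 * a)" using assms by (intro real_sqrt_less_mono) simp
  then show "\<bar>c\<bar> < sqrt (c\<^sup>2 + 4 * a)" by simp
qed

text \<open>
  The right-hand side of the estimate is the positive root of \<open>a m\<^sup>2 + c m / 4 - 1 / 16\<close>, and the initial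
  condition makes this polynomial nonnegative at \<open>u 0\<close>.
\<close>
lemma reciprocal_profile_init_ge:
  assumes p: "4 \<le> p" and b: "0 \<le> b" and a: "0 < a" and u: "reciprocal_profile p b a c u"
  shows "(sqrt (c\<^sup>2 + 4 * a) - c) / (8 * a) \<le> u 0"
proof -
  define R where "R = sqrt (c\<^sup>2 + 4 * a)"
  define m where "m = u 0"
  have m: "0 < m" using u by (simp add: reciprocal_profile_def m_def)
  have R: "\<bar>c\<bar> < R" using sqrt_minus_mult_plus(2)[OF a] by (simp add: R_def)
  have R2: "R\<^sup>2 = c\<^sup>2 + 4 * a"
    unfolding R_def using a by (intro real_sqrt_pow2) (auto intro: add_nonneg_nonneg)
  have "0 \<le> 2 * b / (p + 2) * m powr (- ((p - 4) / 2))" using p b by simp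
  then have "0 \<le> a * m\<^sup>2 + c / 4 * m - 1 / 16"
    using u unfolding reciprocal_profile_def m_def by linarith
  then have "0 \<le> 64 * a * (a * m\<^sup>2 + c / 4 * m - 1 / 16)" using a by simp
  also have "\<dots> = (8 * a * m + c)\<^sup>2 - R\<^sup>2"
    unfolding R2 by (simp add: power2_eq_square algebra_simps)
  finally have "R\<^sup>2 \<le> (8 * a * m + c)\<^sup>2" by simp
  then have "\<bar>R\<bar> \<le> \<bar>8 * a * m + c\<bar>" by (simp add: abs_le_square_iff)
  moreover have "0 < 8 * a * m" using a m by simp
  ultimately have "R \<le> 8 * a * m + c" using R by linarith
  then show ?thesis using a by (simp add: R_def m_def field_simps)
qed

text \<open>
  The term with \<open>b\<close> in the equation is nonnegative, so comparison puts \<open>u\<close> above the solution for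
  \<open>b = 0\<close>, which is \<open>(R cosh (2 \<surd>a x) - c) / (8 a)\<close> with \<open>R\<^sup>2 = c\<^sup>2 + 4 a\<close>. The identity
  \<open>(R - \<bar>c\<bar>) (R + \<bar>c\<bar>) = 4 a\<close> brings this into a form without cancellation.
\<close>
lemma reciprocal_profile_lower_bound:
  assumes p: "4 \<le> p" and b: "0 \<le> b" and a: "0 < a" and u: "reciprocal_profile p b a c u"
  shows "cosh (2 * sqrt a * x) / (2 * (sqrt (c\<^sup>2 + 4 * a) + \<bar>c\<bar>)) \<le> u x"
proof -
  define R where "R = sqrt (c\<^sup>2 + 4 * a)"
  have R: "\<bar>c\<bar> < R" "(R - \<bar>c\<bar>) * (R + \<bar>c\<bar>) = 4 * a"
    using sqrt_minus_mult_plus[OF a, of c] by (auto simp: R_def)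
  obtain u' where u': "u' 0 = 0" "\<And>x. (u has_real_derivative u' x) (at x)"
      "\<And>x. (u' has_real_derivative 4 * a * u x + c / 2
        + b * (2 * (p - 4) / (p + 2)) * u x powr (- ((p - 2) / 2))) (at x)"
    using u unfolding reciprocal_profile_def by blast
  define q where "q = 2 * sqrt a"
  have q: "q * q = 4 * a" using a by (simp add: q_def)
  have "0 \<le> u x + c / (8 * a) - R / (8 * a) * cosh (q * x)"
  proof (rule nonneg_of_second_derivative_ge[where z = "\<lambda>x. u x + c / (8 * a) - R / (8 * a) * cosh (q * x)"
        and z' = "\<lambda>x. u' x - R / (8 * a) * (q * sinh (q * x))"
        and z'' = "\<lambda>x. 4 * a * u x + c / 2
          + b * (2 * (p - 4) / (p + 2)) * u x powr (- ((p - 2) / 2)) - R / (8 * a) * (q * q * cosh (q * x))"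
        and P = "\<lambda>_. 4 * a" and k = "4 * a"])
    fix x :: real
    show "((\<lambda>x. u x + c / (8 * a) - R / (8 * a) * cosh (q * x)) has_real_derivative
            u' x - R / (8 * a) * (q * sinh (q * x))) (at x)"
      by (rule derivative_eq_intros u' refl | simp)+
    show "((\<lambda>x. u' x - R / (8 * a) * (q * sinh (q * x))) has_real_derivative 4 * a * u x + c / 2
          + b * (2 * (p - 4) / (p + 2)) * u x powr (- ((p - 2) / 2)) - R / (8 * a) * (q * q * cosh (q * x))) (at x)"
      by (rule derivative_eq_intros u' refl | simp)+
    have "0 \<le> b * (2 * (p - 4) / (p + 2)) * u x powr (- ((p - 2) / 2))" using p b by simp
    then show "4 * a * (u x + c / (8 * a) - R / (8 * a) * cosh (q * x))
       \<le> 4 * a * u x + c / 2 + b * (2 * (p - 4) / (p + 2)) * u x powr (- ((p - 2) / 2))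
         - R / (8 * a) * (q * q * cosh (q * x))"
      unfolding q using a by (simp add: algebra_simps)
  next
    show "0 \<le> u 0 + c / (8 * a) - R / (8 * a) * cosh (q * 0)"
      using reciprocal_profile_init_ge[OF assms] by (simp add: R_def diff_divide_distrib)
  qed (use a u' in auto)
  then have "R / (8 * a) * cosh (q * x) - c / (8 * a) \<le> u x" by simp
  moreover have "cosh (q * x) / (2 * (R + \<bar>c\<bar>)) \<le> R / (8 * a) * cosh (q * x) - c / (8 * a)"
  proof -
    have "c \<le> \<bar>c\<bar> * cosh (q * x)"
      using mult_left_mono[OF cosh_real_ge_1[of "q * x"], of "\<bar>c\<bar>"] by linarith
    then have "(R - \<bar>c\<bar>) * cosh (q * x) / (8 * a) \<le> (R * cosh (q * x) - c) / (8 * a)"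
      using a by (intro divide_right_mono) (auto simp: algebra_simps)
    moreover have "(R - \<bar>c\<bar>) * cosh (q * x) / (8 * a) = cosh (q * x) / (2 * (R + \<bar>c\<bar>))"
    proof -
      have cancel: "d * t / (2 * (d * e)) = t / (2 * e)" if "d \<noteq> 0" for d e t :: real
        using that by simp
      have "8 * a = 2 * ((R - \<bar>c\<bar>) * (R + \<bar>c\<bar>))" using R(2) by simp
      then show ?thesis by (simp only:) (rule cancel, use R(1) in simp)
    qed
    ultimately show ?thesis by (simp add: diff_divide_distrib)
  qed
  ultimately show ?thesis by (simp add: R_def q_def)
qed

section \<open>Bounds uniform over a box of parameters\<close>

text \<open>
  Constants have to be uniform for \<open>a\<close> and \<open>c\<close> near the given values and for small \<open>b\<close>. The rate \<open>\<mu>\<close>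
  exceeds the growth rate \<open>2 \<surd>a\<close> of every reciprocal profile in the box.
\<close>
locale parameter_box =
  fixes p a1 a2 c2 \<mu> :: real
  assumes p: "4 \<le> p" and a1: "0 < a1" and a12: "a1 \<le> a2" and c2: "0 \<le> c2" and \<mu>: "4 * a2 < \<mu>\<^sup>2"
begin

definition r :: real where "r = (p - 2) / 2"
definition \<rho> :: real where "\<rho> = (p - 4) / 2"
definition \<gamma> :: real where "\<gamma> = 2 * (p - 4) / (p + 2)"
text \<open>
  \<open>u_min\<close> bounds all reciprocal profiles of the box from below. Below \<open>b_max\<close> the coefficient
  \<open>4 a - b \<gamma> r u^(-r-1)\<close> of the linearised equation is nonnegative, as the comparison principle requires.
\<close>
definition u_min :: real where "u_min = 1 / (2 * (sqrt (c2\<^sup>2 + 4 * a2) + c2))"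
definition b_max :: real where "b_max = min 1 (4 * a1 / (\<gamma> * (r * u_min powr (- r - 1)) + 1))"

definition sol :: "real \<Rightarrow> real \<Rightarrow> real \<Rightarrow> (real \<Rightarrow> real) \<Rightarrow> bool" where
  "sol b a c u \<longleftrightarrow> 0 \<le> b \<and> b \<le> b_max \<and> a1 \<le> a \<and> a \<le> a2 \<and> \<bar>c\<bar> \<le> c2 \<and> reciprocal_profile p b a c u"

lemma exponents: "1 \<le> r" "0 \<le> \<rho>" "0 \<le> \<gamma>" "0 < p + 2"
  using p by (auto simp: r_def \<rho>_def \<gamma>_def)

lemma a2: "0 < a2" using a1 a12 by simp

lemma sqrt_pos: "0 < sqrt (c2\<^sup>2 + 4 * a2)"
  using a2 by (simp add: add_nonneg_pos)

lemma u_min_pos: "0 < u_min"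
  unfolding u_min_def using sqrt_pos c2 by (simp add: add_pos_nonneg)

lemma b_max_pos: "0 < b_max"
proof -
  have "0 < \<gamma> * (r * u_min powr (- r - 1)) + 1" using exponents by (intro add_nonneg_pos) auto
  then show ?thesis using a1 by (simp add: b_max_def)
qed

lemma b_max_le: "b_max \<le> 1"
  and b_max_small: "0 \<le> b \<Longrightarrow> b \<le> b_max \<Longrightarrow> b * \<gamma> * (r * u_min powr (- r - 1)) \<le> 4 * a1"
proof -
  show "b_max \<le> 1" by (simp add: b_max_def)
  define N where "N = \<gamma> * (r * u_min powr (- r - 1))"
  have N: "0 \<le> N" using exponents by (simp add: N_def)
  assume b: "0 \<le> b" "b \<le> b_max"
  then have "b \<le> 4 * a1 / (N + 1)" by (simp add: b_max_def N_def)
  then have "b * (N + 1) \<le> 4 * a1" using N by (simp add: pos_le_divide_eq)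
  then show "b * \<gamma> * (r * u_min powr (- r - 1)) \<le> 4 * a1"
    using b by (simp add: N_def algebra_simps)
qed

lemma sol_box:
  assumes "sol b a c u"
  shows "0 \<le> b" "b \<le> b_max" "b \<le> 1" "a1 \<le> a" "0 < a" "a \<le> a2" "\<bar>c\<bar> \<le> c2"
  using assms b_max_le a1 by (auto simp: sol_def)

lemma sol_ode:
  assumes "sol b a c u"
  obtains u' where "u' 0 = 0" "\<And>x. (u has_real_derivative u' x) (at x)"
    "\<And>x. (u' has_real_derivative 4 * a * u x + c / 2 + b * \<gamma> * u x powr (- r)) (at x)"
  using assms unfolding sol_def reciprocal_profile_def r_def \<gamma>_def by blast

lemma sol_measurable:
  assumes "sol b a c u"
  shows "u \<in> borel_measurable lborel"
proof -
  have "\<exists>u'. \<forall>x. (u has_real_derivative u' x) (at x)"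
    using assms unfolding sol_def reciprocal_profile_def by blast
  then obtain u' where "\<And>x. (u has_real_derivative u' x) (at x)" by blast
  then have "continuous_on UNIV u" by (intro DERIV_continuous_on[of UNIV u u']) simp
  then show ?thesis by (simp add: borel_measurable_continuous_onI)
qed

lemma sol_init:
  assumes "sol b a c u"
  shows "a * (u 0)\<^sup>2 + c / 4 * u 0 - 1 / 16 - 2 * b / (p + 2) * u 0 powr (- \<rho>) = 0"
  using assms unfolding sol_def reciprocal_profile_def \<rho>_def by blast

lemma sqrt_sum_le:
  assumes "sol b a c u"
  shows "sqrt (c\<^sup>2 + 4 * a) + \<bar>c\<bar> \<le> sqrt (c2\<^sup>2 + 4 * a2) + c2"
proof (intro add_mono real_sqrt_le_mono)
  show "c\<^sup>2 \<le> c2\<^sup>2" using sol_box[OF assms] by (simp add: abs_le_square_iff[symmetric])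
qed (use sol_box[OF assms] in auto)

lemma sol_ge_cosh:
  assumes "sol b a c u"
  shows "u_min * cosh (2 * sqrt a * x) \<le> u x"
proof -
  have "0 < sqrt (c\<^sup>2 + 4 * a) + \<bar>c\<bar>"
    using sol_box(5)[OF assms] by (intro add_pos_nonneg) (auto simp: add_nonneg_pos)
  then have "u_min \<le> 1 / (2 * (sqrt (c\<^sup>2 + 4 * a) + \<bar>c\<bar>))"
    unfolding u_min_def using sqrt_sum_le[OF assms] by (intro divide_left_mono) auto
  then have "u_min * cosh (2 * sqrt a * x) \<le> cosh (2 * sqrt a * x) / (2 * (sqrt (c\<^sup>2 + 4 * a) + \<bar>c\<bar>))"
    using mult_right_mono[of u_min _ "cosh (2 * sqrt a * x)"] by fastforce
  also have "\<dots> \<le> u x"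
    using assms sol_box[OF assms] by (intro reciprocal_profile_lower_bound[OF p]) (auto simp: sol_def)
  finally show ?thesis .
qed

lemma sol_ge:
  assumes "sol b a c u"
  shows "u_min \<le> u x"
proof -
  have "u_min * 1 \<le> u_min * cosh (2 * sqrt a * x)"
    using u_min_pos by (intro mult_left_mono) (auto simp: cosh_real_ge_1)
  then show ?thesis using sol_ge_cosh[OF assms, of x] by simp
qed

lemma sol_pos: "sol b a c u \<Longrightarrow> 0 < u x"
  using sol_ge[of b a c u x] u_min_pos by simp

text \<open>
  This keeps the derivative of the initial equation with respect to \<open>u 0\<close> away from zero, so that this
  equation determines \<open>u 0\<close> as a Lipschitz function of the parameters.
\<close>
lemma sol_init_nondegenerate:
  assumes "sol b a c u"
  shows "a1 * u_min \<le> a * u 0 + c / 4"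
proof -
  define R where "R = sqrt (c\<^sup>2 + 4 * a)"
  note box = sol_box[OF assms]
  have R: "\<bar>c\<bar> < R" "(R - \<bar>c\<bar>) * (R + \<bar>c\<bar>) = 4 * a"
    using sqrt_minus_mult_plus[OF box(5), of c] by (auto simp: R_def)
  have "(R - c) / (8 * a) \<le> u 0"
    unfolding R_def using assms box by (intro reciprocal_profile_init_ge[OF p]) (auto simp: sol_def)
  then have "R + c \<le> 8 * (a * u 0 + c / 4)" using box(5) by (simp add: field_simps)
  have "4 * a * (2 * u_min) = 4 * a / (sqrt (c2\<^sup>2 + 4 * a2) + c2)"
  proof -
    have e: "4 * a * (2 * (1 / (2 * S))) = 4 * a / S" for S :: real by simp
    show ?thesis unfolding u_min_def by (rule e)
  qed
  also have "\<dots> \<le> 4 * a / (R + \<bar>c\<bar>)"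
    using sqrt_sum_le[OF assms] R(1) box(5) sqrt_pos c2 unfolding R_def
    by (intro divide_left_mono mult_pos_pos) auto
  also have "\<dots> = R - \<bar>c\<bar>" using R by (simp add: field_simps)
  also have "\<dots> \<le> R + c" by simp
  also have "\<dots> \<le> 8 * (a * u 0 + c / 4)" by fact
  finally have "a * u_min \<le> a * u 0 + c / 4" by simp
  moreover have "a1 * u_min \<le> a * u_min" using box u_min_pos by simp
  ultimately show ?thesis by linarith
qed

lemma powr_le_u_min:
  assumes "sol b a c u" "s \<le> 0"
  shows "u x powr s \<le> u_min powr s"
  using sol_ge[OF assms(1)] u_min_pos assms(2) by (intro powr_mono2') auto

lemma init_bound: "\<exists>M>0. \<forall>b a c u. sol b a c u \<longrightarrow> u 0 \<le> M"
proof (intro exI conjI allI impI)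
  define T where "T = c2 + 1 + u_min powr (- \<rho>)"
  show "0 < 1 + T / a1" unfolding T_def using c2 a1 by (intro add_pos_nonneg) (auto intro!: divide_nonneg_nonneg)
  fix b a c u assume s: "sol b a c u"
  note box = sol_box[OF s]
  define m where "m = u 0"
  have T0: "0 \<le> T" using c2 by (simp add: T_def)
  show "u 0 \<le> 1 + T / a1"
  proof (cases "m \<le> 1")
    case True
    then show ?thesis using T0 a1 by (simp add: m_def add_increasing2)
  next
    case False
    have "2 * b / (p + 2) \<le> 1" using box exponents p by (simp add: divide_le_eq)
    then have "2 * b / (p + 2) * m powr (- \<rho>) \<le> 1 * u_min powr (- \<rho>)"
      unfolding m_def using box exponents by (intro mult_mono powr_le_u_min[OF s]) auto
    then have "a * m\<^sup>2 \<le> 1 + u_min powr (- \<rho>) - c / 4 * m"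
      using sol_init[OF s] by (simp add: m_def)
    also have "\<dots> \<le> (1 + u_min powr (- \<rho>)) * m + c2 * m"
    proof -
      have "1 + u_min powr (- \<rho>) \<le> (1 + u_min powr (- \<rho>)) * m"
        using mult_left_mono[of 1 m "1 + u_min powr (- \<rho>)"] False by simp
      moreover have "- (c / 4) * m \<le> c2 * m" using box False c2 by (intro mult_right_mono) auto
      ultimately show ?thesis by simp
    qed
    also have "\<dots> = T * m" by (simp add: T_def algebra_simps)
    finally have "a * m * m \<le> T * m" by (simp add: power2_eq_square)
    then have "a * m \<le> T" using False by simp
    moreover have "a1 * m \<le> a * m" using box False by simp
    ultimately have "m \<le> T / a1" using a1 by (simp add: field_simps)
    then show ?thesis by (simp add: m_def)
  qed
qed

text \<open>
  Apart from \<open>4 a u\<close> the right-hand side of the equation is bounded, since \<open>u \<ge> u_min\<close>.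
\<close>
lemma growth_bound: "\<exists>M>0. \<forall>b a c u x. sol b a c u \<longrightarrow> u x \<le> M * cosh (\<mu> * x)"
proof -
  obtain M where M: "0 < M" "\<And>b a c u. sol b a c u \<Longrightarrow> u 0 \<le> M" using init_bound by blast
  define A where "A = c2 / 2 + \<gamma> * u_min powr (- r)"
  have A: "0 \<le> A" using c2 exponents by (simp add: A_def)
  show ?thesis
  proof (intro exI conjI allI impI)
    show "0 < M + A / (\<mu>\<^sup>2 - 4 * a2)" using M A \<mu> by (simp add: add_pos_nonneg)
    fix b a c u x assume s: "sol b a c u"
    note box = sol_box[OF s]
    obtain u' where u': "u' 0 = 0" "\<And>x. (u has_real_derivative u' x) (at x)"
      "\<And>x. (u' has_real_derivative 4 * a * u x + c / 2 + b * \<gamma> * u x powr (- r)) (at x)"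
      using sol_ode[OF s] by blast
    have "\<bar>u x\<bar> \<le> (M + A / (\<mu>\<^sup>2 - 4 * a2)) * cosh (\<mu> * x)"
    proof (rule cosh_bound_of_linear_ode[OF u'(2,3)])
      fix x
      have "b * \<gamma> * u x powr (- r) \<le> 1 * \<gamma> * u_min powr (- r)"
        using box exponents by (intro mult_mono powr_le_u_min[OF s]) auto
      moreover have "0 \<le> b * \<gamma> * u x powr (- r)" using box exponents by simp
      ultimately have "\<bar>c / 2 + b * \<gamma> * u x powr (- r)\<bar> \<le> A"
        using box(7) unfolding A_def by linarith
      also have "A \<le> A * cosh (\<mu> * x)" using mult_left_mono[OF cosh_real_ge_1 A] by simp
      finally show "\<bar>4 * a * u x + c / 2 + b * \<gamma> * u x powr (- r) - 4 * a * u x\<bar> \<le> A * cosh (\<mu> * x)"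
        by simp
    qed (use box \<mu> u' M(2)[OF s] sol_pos[OF s, of 0] in auto)
    then show "u x \<le> (M + A / (\<mu>\<^sup>2 - 4 * a2)) * cosh (\<mu> * x)" by simp
  qed
qed

section \<open>Lipschitz dependence on the parameters\<close>

text \<open>
  The difference of the two initial equations is linear in \<open>u 0 - u' 0\<close> once the power is written by
  the mean value theorem; the factor \<open>D\<close> is bounded below by the nondegeneracy of the initial equation.
\<close>
lemma init_lipschitz:
  "\<exists>K>0. \<forall>b a c u b' a' c' u'. sol b a c u \<longrightarrow> sol b' a' c' u' \<longrightarrow>
     \<bar>u 0 - u' 0\<bar> \<le> K * (\<bar>b - b'\<bar> + \<bar>a - a'\<bar> + \<bar>c - c'\<bar>)"
proof -
  obtain M where M: "0 < M" "\<And>b a c u. sol b a c u \<Longrightarrow> u 0 \<le> M" using init_bound by blast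
  define d where "d = 2 * a1 * u_min"
  have d: "0 < d" using a1 u_min_pos by (simp add: d_def)
  define T where "T = M\<^sup>2 + M + u_min powr (- \<rho>)"
  have T: "0 < T" using M by (simp add: T_def add_pos_nonneg)
  show ?thesis
  proof (intro exI conjI allI impI)
    show "0 < T / d" using T d by simp
    fix b a c u b' a' c' u' assume s: "sol b a c u" and s': "sol b' a' c' u'"
    note box = sol_box[OF s] and box' = sol_box[OF s']
    define m m' where "m = u 0" and "m' = u' 0"
    obtain t where t: "u_min \<le> t" "m powr (- \<rho>) - m' powr (- \<rho>) = - (\<rho> * t powr (- \<rho> - 1)) * (m - m')"
      using powr_neg_mvt[OF u_min_pos sol_ge[OF s] sol_ge[OF s']] unfolding m_def m'_def by blast
    define D where "D = a * (m + m') + c / 4 + 2 * b / (p + 2) * (\<rho> * t powr (- \<rho> - 1))"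
    define X where "X = - ((a - a') * m'\<^sup>2) - (c - c') / 4 * m' + 2 * (b - b') / (p + 2) * m' powr (- \<rho>)"
    have e: "m powr (- \<rho>) = m' powr (- \<rho>) - (\<rho> * t powr (- \<rho> - 1)) * (m - m')"
      using t(2) by simp
    have eq: "(m - m') * D = X"
    proof -
      have "a * m\<^sup>2 + c / 4 * m - 1 / 16 - 2 * b / (p + 2) * m powr (- \<rho>)
         - (a' * m'\<^sup>2 + c' / 4 * m' - 1 / 16 - 2 * b' / (p + 2) * m' powr (- \<rho>)) = 0"
        using sol_init[OF s] sol_init[OF s'] by (simp add: m_def m'_def)
      then show ?thesis
        unfolding e D_def X_def by (simp add: algebra_simps power2_eq_square add_divide_distrib diff_divide_distrib)
    qed
    have Dd: "d \<le> D"
    proof -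
      have "a1 * u_min \<le> a * m'" using box sol_ge[OF s', of 0] u_min_pos a1
        unfolding m'_def by (intro mult_mono) auto
      moreover have "0 \<le> 2 * b / (p + 2) * (\<rho> * t powr (- \<rho> - 1))" using box exponents by simp
      ultimately show ?thesis
        using sol_init_nondegenerate[OF s] unfolding D_def d_def m_def by (simp add: distrib_left)
    qed
    have m': "0 < m'" "m' \<le> M" using M(2)[OF s'] sol_pos[OF s'] by (auto simp: m'_def)
    have "\<bar>X\<bar> \<le> \<bar>a - a'\<bar> * M\<^sup>2 + \<bar>c - c'\<bar> * M + \<bar>b - b'\<bar> * u_min powr (- \<rho>)"
    proof -
      have x1: "\<bar>- ((a - a') * m'\<^sup>2)\<bar> \<le> \<bar>a - a'\<bar> * M\<^sup>2"
        using m' by (simp add: abs_mult mult_left_mono power_mono)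
      have x2: "\<bar>(c - c') / 4 * m'\<bar> \<le> \<bar>c - c'\<bar> * M"
        unfolding abs_mult using m' by (intro mult_mono) auto
      have "\<bar>2 * (b - b') / (p + 2)\<bar> \<le> \<bar>b - b'\<bar>"
      proof -
        have "2 * \<bar>b - b'\<bar> \<le> (p + 2) * \<bar>b - b'\<bar>" using p by (intro mult_right_mono) auto
        moreover have "\<bar>2 * (b - b') / (p + 2)\<bar> = 2 * \<bar>b - b'\<bar> / (p + 2)"
          unfolding abs_divide abs_mult using exponents by simp
        ultimately show ?thesis using exponents by (simp add: divide_le_eq mult.commute)
      qed
      then have x3: "\<bar>2 * (b - b') / (p + 2) * m' powr (- \<rho>)\<bar> \<le> \<bar>b - b'\<bar> * u_min powr (- \<rho>)"
        unfolding abs_mult[of _ "m' powr (- \<rho>)"]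
        using powr_le_u_min[OF s', of "- \<rho>" 0, folded m'_def] exponents
        by (intro mult_mono) auto
      show ?thesis unfolding X_def by (intro abs_add_bound abs_diff_bound x1 x2 x3)
    qed
    also have "\<dots> \<le> T * (\<bar>b - b'\<bar> + \<bar>a - a'\<bar> + \<bar>c - c'\<bar>)"
    proof -
      have "0 \<le> M\<^sup>2" "0 \<le> M" "0 \<le> u_min powr (- \<rho>)" using M by auto
      then show ?thesis unfolding T_def by (simp add: algebra_simps add_increasing add_increasing2)
    qed
    finally have "\<bar>m - m'\<bar> * D \<le> T * (\<bar>b - b'\<bar> + \<bar>a - a'\<bar> + \<bar>c - c'\<bar>)"
      using Dd d unfolding eq[symmetric] by (simp add: abs_mult)
    moreover have "\<bar>m - m'\<bar> * d \<le> \<bar>m - m'\<bar> * D" using Dd by (intro mult_left_mono) auto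
    ultimately have "\<bar>m - m'\<bar> \<le> T * (\<bar>b - b'\<bar> + \<bar>a - a'\<bar> + \<bar>c - c'\<bar>) / d"
      using d by (simp add: pos_le_divide_eq)
    then show "\<bar>u 0 - u' 0\<bar> \<le> T / d * (\<bar>b - b'\<bar> + \<bar>a - a'\<bar> + \<bar>c - c'\<bar>)"
      by (simp add: m_def m'_def)
  qed
qed

text \<open>
  The difference of two solutions solves a linear equation whose coefficient contains the divided
  difference of \<open>u^(-r)\<close> and whose forcing is the difference of the parameters times \<open>O(cosh (\<mu> x))\<close>.
\<close>
lemma sol_lipschitz:
  "\<exists>K>0. \<forall>b a c u b' a' c' u' x. sol b a c u \<longrightarrow> sol b' a' c' u' \<longrightarrow>
     \<bar>u x - u' x\<bar> \<le> K * (\<bar>b - b'\<bar> + \<bar>a - a'\<bar> + \<bar>c - c'\<bar>) * cosh (\<mu> * x)"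
proof -
  obtain K0 where K0: "0 < K0" "\<And>b a c u b' a' c' u'. sol b a c u \<Longrightarrow> sol b' a' c' u' \<Longrightarrow>
     \<bar>u 0 - u' 0\<bar> \<le> K0 * (\<bar>b - b'\<bar> + \<bar>a - a'\<bar> + \<bar>c - c'\<bar>)" using init_lipschitz by blast
  obtain M where M: "0 < M" "\<And>b a c u x. sol b a c u \<Longrightarrow> u x \<le> M * cosh (\<mu> * x)"
    using growth_bound by blast
  define T where "T = 4 * M + 1 + \<gamma> * u_min powr (- r)"
  have T: "0 < T" using M exponents unfolding T_def by (intro add_pos_nonneg) auto
  show ?thesis
  proof (intro exI conjI allI impI)
    show "0 < K0 + T / (\<mu>\<^sup>2 - 4 * a2)" using K0 T \<mu> by (simp add: add_pos_pos)
    fix b a c u b' a' c' u' x assume s: "sol b a c u" and s': "sol b' a' c' u'"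
    note box = sol_box[OF s] and box' = sol_box[OF s']
    define \<Delta> where "\<Delta> = \<bar>b - b'\<bar> + \<bar>a - a'\<bar> + \<bar>c - c'\<bar>"
    have \<Delta>: "0 \<le> \<Delta>" "\<bar>b - b'\<bar> \<le> \<Delta>" "\<bar>a - a'\<bar> \<le> \<Delta>" "\<bar>c - c'\<bar> \<le> \<Delta>" by (auto simp: \<Delta>_def)
    obtain v where v: "v 0 = 0" "\<And>x. (u has_real_derivative v x) (at x)"
      "\<And>x. (v has_real_derivative 4 * a * u x + c / 2 + b * \<gamma> * u x powr (- r)) (at x)"
      using sol_ode[OF s] by blast
    obtain v' where v': "v' 0 = 0" "\<And>x. (u' has_real_derivative v' x) (at x)"
      "\<And>x. (v' has_real_derivative 4 * a' * u' x + c' / 2 + b' * \<gamma> * u' x powr (- r)) (at x)"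
      using sol_ode[OF s'] by blast
    have "\<exists>t. \<forall>x. u_min \<le> t x \<and> u x powr (- r) - u' x powr (- r) = - (r * t x powr (- r - 1)) * (u x - u' x)"
      using powr_neg_mvt[OF u_min_pos sol_ge[OF s] sol_ge[OF s'], of _ _ r] by (intro choice) blast
    then obtain t where t: "\<And>x. u_min \<le> t x"
      "\<And>x. u x powr (- r) - u' x powr (- r) = - (r * t x powr (- r - 1)) * (u x - u' x)" by blast
    have "\<bar>u x - u' x\<bar> \<le> (K0 * \<Delta> + T * \<Delta> / (\<mu>\<^sup>2 - 4 * a2)) * cosh (\<mu> * x)"
    proof (rule cosh_bound_of_linear_ode[where y = "\<lambda>x. u x - u' x" and y' = "\<lambda>x. v x - v' x"
          and P = "\<lambda>x. 4 * a - b * \<gamma> * (r * t x powr (- r - 1))"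
          and y'' = "\<lambda>x. (4 * a * u x + c / 2 + b * \<gamma> * u x powr (- r))
             - (4 * a' * u' x + c' / 2 + b' * \<gamma> * u' x powr (- r))"])
      fix x
      show "((\<lambda>x. u x - u' x) has_real_derivative v x - v' x) (at x)"
        by (intro DERIV_diff v v')
      show "((\<lambda>x. v x - v' x) has_real_derivative (4 * a * u x + c / 2 + b * \<gamma> * u x powr (- r))
             - (4 * a' * u' x + c' / 2 + b' * \<gamma> * u' x powr (- r))) (at x)"
        by (intro DERIV_diff v v')
      have tp: "t x powr (- r - 1) \<le> u_min powr (- r - 1)"
        using t(1) u_min_pos exponents by (intro powr_mono2') auto
      then have "b * \<gamma> * (r * t x powr (- r - 1)) \<le> b * \<gamma> * (r * u_min powr (- r - 1))"
        using box exponents by (intro mult_left_mono) auto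
      also have "\<dots> \<le> 4 * a1" using b_max_small box by simp
      finally show "0 \<le> 4 * a - b * \<gamma> * (r * t x powr (- r - 1))" using box by simp
      have "0 \<le> b * \<gamma> * (r * t x powr (- r - 1))" using box exponents by simp
      then show "4 * a - b * \<gamma> * (r * t x powr (- r - 1)) \<le> 4 * a2" using box by simp
      have e: "u x powr (- r) = u' x powr (- r) - (r * t x powr (- r - 1)) * (u x - u' x)"
        using t(2)[of x] by simp
      have "4 * a * u x + c / 2 + b * \<gamma> * u x powr (- r) - (4 * a' * u' x + c' / 2 + b' * \<gamma> * u' x powr (- r))
          - (4 * a - b * \<gamma> * (r * t x powr (- r - 1))) * (u x - u' x)
          = 4 * (a - a') * u' x + (c - c') / 2 + (b - b') * (\<gamma> * u' x powr (- r))"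
        unfolding e by (simp add: algebra_simps add_divide_distrib diff_divide_distrib)
      moreover have "\<bar>4 * (a - a') * u' x + (c - c') / 2 + (b - b') * (\<gamma> * u' x powr (- r))\<bar> \<le> T * \<Delta> * cosh (\<mu> * x)"
      proof -
        define C where "C = cosh (\<mu> * x)"
        have C: "1 \<le> C" by (simp add: C_def cosh_real_ge_1)
        have "\<bar>4 * (a - a') * u' x\<bar> = 4 * (\<bar>a - a'\<bar> * u' x)"
          unfolding abs_mult using sol_pos[OF s', of x] by simp
        also have "\<dots> \<le> 4 * (\<Delta> * (M * C))"
          using \<Delta> M(2)[OF s', of x] sol_pos[OF s', of x] unfolding C_def by (intro mult_left_mono mult_mono) auto
        finally have x1: "\<bar>4 * (a - a') * u' x\<bar> \<le> 4 * M * \<Delta> * C" by (simp add: mult_ac)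
        have x2: "\<bar>(c - c') / 2\<bar> \<le> \<Delta> * C"
          using \<Delta> mult_left_mono[OF C \<Delta>(1)] by simp
        have "\<bar>(b - b') * (\<gamma> * u' x powr (- r))\<bar> = \<bar>b - b'\<bar> * (\<gamma> * u' x powr (- r)) * 1"
          using exponents by (simp add: abs_mult)
        also have "\<dots> \<le> \<Delta> * (\<gamma> * u_min powr (- r)) * C"
        proof -
          have "u' x powr (- r) \<le> u_min powr (- r)" using powr_le_u_min[OF s'] exponents(1) by simp
          from mult_mono[OF mult_mono[OF \<Delta>(2) mult_left_mono[OF this exponents(3)]] C]
          show ?thesis using \<Delta>(1) exponents(3) by simp
        qed
        finally have x3: "\<bar>(b - b') * (\<gamma> * u' x powr (- r))\<bar> \<le> \<Delta> * (\<gamma> * u_min powr (- r)) * C" .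
        have "T * \<Delta> * C = 4 * M * \<Delta> * C + \<Delta> * C + \<Delta> * (\<gamma> * u_min powr (- r)) * C"
          by (simp add: T_def algebra_simps)
        then show ?thesis
          unfolding C_def[symmetric] using abs_add_bound[OF abs_add_bound[OF x1 x2] x3] by (simp only:)
      qed
      ultimately show "\<bar>4 * a * u x + c / 2 + b * \<gamma> * u x powr (- r) - (4 * a' * u' x + c' / 2 + b' * \<gamma> * u' x powr (- r))
          - (4 * a - b * \<gamma> * (r * t x powr (- r - 1))) * (u x - u' x)\<bar> \<le> T * \<Delta> * cosh (\<mu> * x)" by simp
    qed (use \<mu> v v' K0(2)[OF s s'] in \<open>auto simp: \<Delta>_def\<close>)
    then show "\<bar>u x - u' x\<bar> \<le> (K0 + T / (\<mu>\<^sup>2 - 4 * a2)) * (\<bar>b - b'\<bar> + \<bar>a - a'\<bar> + \<bar>c - c'\<bar>) * cosh (\<mu> * x)"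
      unfolding \<Delta>_def[symmetric] by (simp add: algebra_simps)
  qed
qed

end

section \<open>Difference quotients in the parameters\<close>

text \<open>
  By completeness, difference quotients that approach each other at a linear rate have a limit; this is
  how the parameter derivatives are obtained.
\<close>
lemma convergent_at_zero_of_cauchy_rate:
  fixes q :: "real \<Rightarrow> real"
  assumes h0: "0 < h0"
    and C: "\<And>h k. h \<noteq> 0 \<Longrightarrow> k \<noteq> 0 \<Longrightarrow> \<bar>h\<bar> < h0 \<Longrightarrow> \<bar>k\<bar> < h0 \<Longrightarrow> \<bar>q h - q k\<bar> \<le> C * (\<bar>h\<bar> + \<bar>k\<bar>)"
  shows "\<exists>l. (q \<longlongrightarrow> l) (at 0)"
proof -
  define k where "k n = h0 / (real n + 2)" for n :: nat
  have k: "0 < k n" "k n < h0" for n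
  proof -
    show "0 < k n" using h0 by (simp add: k_def)
    have "h0 * 1 < h0 * (real n + 2)" using h0 by (intro mult_strict_left_mono) auto
    then show "k n < h0" by (simp add: k_def pos_divide_less_eq)
  qed
  have k0: "k \<longlonglongrightarrow> 0" unfolding k_def by real_asymp
  have "Cauchy (\<lambda>n. q (k n))"
  proof (rule metric_CauchyI)
    fix e :: real assume "0 < e"
    have "(\<lambda>n. \<bar>C\<bar> * k n) \<longlonglongrightarrow> \<bar>C\<bar> * 0" by (intro tendsto_intros k0)
    then have "\<forall>\<^sub>F n in sequentially. \<bar>C\<bar> * k n < e / 2"
      using \<open>0 < e\<close> by (intro order_tendstoD(2)) auto
    then obtain N where N: "\<And>n. N \<le> n \<Longrightarrow> \<bar>C\<bar> * k n < e / 2" by (auto simp: eventually_sequentially)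
    have "dist (q (k m)) (q (k n)) < e" if "N \<le> m" "N \<le> n" for m n
    proof -
      have "\<bar>q (k m) - q (k n)\<bar> \<le> C * (\<bar>k m\<bar> + \<bar>k n\<bar>)"
        using k[of m] k[of n] by (intro C) auto
      also have "\<dots> \<le> \<bar>C\<bar> * (\<bar>k m\<bar> + \<bar>k n\<bar>)" by (intro mult_right_mono) auto
      also have "\<dots> = \<bar>C\<bar> * k m + \<bar>C\<bar> * k n" using k[of m] k[of n] by (simp add: distrib_left)
      finally show ?thesis using N[of m] N[of n] that by (simp add: dist_real_def)
    qed
    then show "\<exists>M. \<forall>m\<ge>M. \<forall>n\<ge>M. dist (q (k m)) (q (k n)) < e" by blast
  qed
  then obtain l where l: "(\<lambda>n. q (k n)) \<longlonglongrightarrow> l"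
    using Cauchy_convergent_iff convergent_def by blast
  have le: "\<bar>q h - l\<bar> \<le> C * \<bar>h\<bar>" if h: "h \<noteq> 0" "\<bar>h\<bar> < h0" for h
  proof (rule LIMSEQ_le)
    show "(\<lambda>n. \<bar>q h - q (k n)\<bar>) \<longlonglongrightarrow> \<bar>q h - l\<bar>" by (intro tendsto_intros l)
    have "(\<lambda>n. C * (\<bar>h\<bar> + \<bar>k n\<bar>)) \<longlonglongrightarrow> C * (\<bar>h\<bar> + \<bar>0\<bar>)" by (intro tendsto_intros k0)
    then show "(\<lambda>n. C * (\<bar>h\<bar> + \<bar>k n\<bar>)) \<longlonglongrightarrow> C * \<bar>h\<bar>" by simp
    have "\<bar>q h - q (k n)\<bar> \<le> C * (\<bar>h\<bar> + \<bar>k n\<bar>)" for n using k[of n] h by (intro C) auto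
    then show "\<exists>N. \<forall>n\<ge>N. \<bar>q h - q (k n)\<bar> \<le> C * (\<bar>h\<bar> + \<bar>k n\<bar>)" by blast
  qed
  have "((\<lambda>h. q h - l) \<longlongrightarrow> 0) (at 0)"
  proof (rule Lim_null_comparison)
    show "\<forall>\<^sub>F h in at 0. norm (q h - l) \<le> C * \<bar>h\<bar>"
      unfolding eventually_at using h0 le by (intro exI[of _ h0]) auto
    have "((\<lambda>h. C * \<bar>h\<bar>) \<longlongrightarrow> C * \<bar>0\<bar>) (at 0)" by (intro tendsto_intros)
    then show "((\<lambda>h. C * \<bar>h\<bar>) \<longlongrightarrow> 0) (at 0)" by simp
  qed
  then show ?thesis using LIM_zero_cancel by blast
qed

lemma cosh_le_cosh_double:
  fixes t :: real
  shows "cosh t \<le> cosh (2 * t)" "(cosh t)\<^sup>2 \<le> cosh (2 * t)"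
proof -
  show *: "(cosh t)\<^sup>2 \<le> cosh (2 * t)"
    using cosh_square_eq[of t] by (simp add: cosh_double)
  have "cosh t * 1 \<le> cosh t * cosh t" using cosh_real_ge_1[of t] by (intro mult_left_mono) auto
  then show "cosh t \<le> cosh (2 * t)" using * unfolding power2_eq_square by linarith
qed

context parameter_box
begin

text \<open>
  Parameters move along \<open>h \<mapsto> (a + \<alpha> h + \<alpha>1 h\<^sup>2, c + \<eta> h)\<close>. The quadratic term is present because
  \<open>a = \<omega> - c\<^sup>2 / 4\<close> is quadratic in \<open>c\<close>.
\<close>
lemma curve_lipschitz:
  fixes \<alpha> \<alpha>1 \<eta> :: real
  shows "\<exists>K>0. \<forall>b a c u h uh x. \<bar>h\<bar> \<le> 1 \<longrightarrow> sol b a c u \<longrightarrow> sol b (a + \<alpha> * h + \<alpha>1 * h\<^sup>2) (c + \<eta> * h) uh \<longrightarrow>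
     \<bar>uh x - u x\<bar> \<le> K * \<bar>h\<bar> * cosh (\<mu> * x)"
proof -
  obtain K where K: "0 < K" "\<And>b a c u b' a' c' u' x. sol b a c u \<Longrightarrow> sol b' a' c' u' \<Longrightarrow>
     \<bar>u x - u' x\<bar> \<le> K * (\<bar>b - b'\<bar> + \<bar>a - a'\<bar> + \<bar>c - c'\<bar>) * cosh (\<mu> * x)" using sol_lipschitz by blast
  show ?thesis
  proof (intro exI conjI allI impI)
    show "0 < K * (\<bar>\<alpha>\<bar> + \<bar>\<alpha>1\<bar> + \<bar>\<eta>\<bar> + 1)" using K by simp
    fix b a c u h uh x
    assume h: "\<bar>h\<bar> \<le> 1" and s: "sol b a c u" and sh: "sol b (a + \<alpha> * h + \<alpha>1 * h\<^sup>2) (c + \<eta> * h) uh"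
    have quad: "\<bar>\<alpha>1 * h\<^sup>2\<bar> \<le> \<bar>\<alpha>1\<bar> * \<bar>h\<bar>"
      using mult_left_mono[OF h, of "\<bar>h\<bar>"] by (simp add: abs_mult power2_eq_square mult_left_mono)
    have da: "\<bar>\<alpha> * h + \<alpha>1 * h\<^sup>2\<bar> \<le> \<bar>\<alpha>\<bar> * \<bar>h\<bar> + \<bar>\<alpha>1\<bar> * \<bar>h\<bar>"
      by (rule abs_add_bound[OF _ quad]) (simp add: abs_mult)
    have "\<bar>\<alpha> * h + \<alpha>1 * h\<^sup>2\<bar> + \<bar>\<eta>\<bar> * \<bar>h\<bar> \<le> (\<bar>\<alpha>\<bar> + \<bar>\<alpha>1\<bar> + \<bar>\<eta>\<bar> + 1) * \<bar>h\<bar>"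
      unfolding distrib_right by (rule order_trans[OF add_right_mono[OF da]]) simp
    then have "\<bar>b - b\<bar> + \<bar>a + \<alpha> * h + \<alpha>1 * h\<^sup>2 - a\<bar> + \<bar>c + \<eta> * h - c\<bar> \<le> (\<bar>\<alpha>\<bar> + \<bar>\<alpha>1\<bar> + \<bar>\<eta>\<bar> + 1) * \<bar>h\<bar>"
      by (simp add: abs_mult)
    then have "K * (\<bar>b - b\<bar> + \<bar>a + \<alpha> * h + \<alpha>1 * h\<^sup>2 - a\<bar> + \<bar>c + \<eta> * h - c\<bar>) * cosh (\<mu> * x)
      \<le> K * ((\<bar>\<alpha>\<bar> + \<bar>\<alpha>1\<bar> + \<bar>\<eta>\<bar> + 1) * \<bar>h\<bar>) * cosh (\<mu> * x)"
      using K(1) by (intro mult_right_mono mult_left_mono) auto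
    from order_trans[OF K(2)[OF sh s] this]
    show "\<bar>uh x - u x\<bar> \<le> K * (\<bar>\<alpha>\<bar> + \<bar>\<alpha>1\<bar> + \<bar>\<eta>\<bar> + 1) * \<bar>h\<bar> * cosh (\<mu> * x)"
      by (simp only: mult.assoc)
  qed
qed

text \<open>
  The derivative of \<open>a m\<^sup>2 + c m / 4 - 1 / 16 - 2 b / (p + 2) m^(-\<rho>)\<close> with respect to \<open>m\<close>.
\<close>
definition init_coeff :: "real \<Rightarrow> real \<Rightarrow> real \<Rightarrow> real \<Rightarrow> real" where
  "init_coeff b a c m = 2 * a * m + c / 4 + 2 * b / (p + 2) * (\<rho> * m powr (- \<rho> - 1))"

lemma init_coeff_ge:
  assumes "sol b a c u"
  shows "2 * a1 * u_min \<le> init_coeff b a c (u 0)"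
proof -
  note box = sol_box[OF assms]
  have "a1 * u_min \<le> a * u 0" using box sol_ge[OF assms, of 0] u_min_pos a1 by (intro mult_mono) auto
  moreover have "0 \<le> 2 * b / (p + 2) * (\<rho> * u 0 powr (- \<rho> - 1))" using box exponents by simp
  ultimately show ?thesis using sol_init_nondegenerate[OF assms] by (simp add: init_coeff_def)
qed

lemma two_b_div_le: "0 \<le> b \<Longrightarrow> 0 \<le> 2 * b / (p + 2) \<and> 2 * b / (p + 2) \<le> b"
proof -
  assume "0 \<le> b"
  then have "b * 2 \<le> b * (p + 2)" using p by (intro mult_left_mono) auto
  then show ?thesis using exponents \<open>0 \<le> b\<close> by (simp add: divide_le_eq mult.commute)
qed

text \<open>
  Implicit differentiation of the initial equation, with an error of first order in \<open>h\<close>.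
\<close>
lemma init_quotient:
  fixes \<alpha> \<alpha>1 \<eta> :: real
  shows "\<exists>C>0. \<forall>b a c u h uh. h \<noteq> 0 \<longrightarrow> \<bar>h\<bar> \<le> 1 \<longrightarrow> sol b a c u \<longrightarrow> sol b (a + \<alpha> * h + \<alpha>1 * h\<^sup>2) (c + \<eta> * h) uh \<longrightarrow>
     \<bar>(uh 0 - u 0) / h + (\<alpha> * (u 0)\<^sup>2 + \<eta> / 4 * u 0) / init_coeff b a c (u 0)\<bar> \<le> C * \<bar>h\<bar>"
proof -
  obtain K where K: "0 < K" "\<And>b a c u h uh x. \<bar>h\<bar> \<le> 1 \<Longrightarrow> sol b a c u \<Longrightarrow>
     sol b (a + \<alpha> * h + \<alpha>1 * h\<^sup>2) (c + \<eta> * h) uh \<Longrightarrow>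
     \<bar>uh x - u x\<bar> \<le> K * \<bar>h\<bar> * cosh (\<mu> * x)" using curve_lipschitz by blast
  obtain M where M: "0 < M" "\<And>b a c u. sol b a c u \<Longrightarrow> u 0 \<le> M" using init_bound by blast
  define d where "d = 2 * a1 * u_min"
  have d: "0 < d" using a1 u_min_pos by (simp add: d_def)
  define N where "N = \<rho> * (\<rho> + 1) * u_min powr (- \<rho> - 2)"
  have N: "0 \<le> N" using exponents by (simp add: N_def)
  define T where "T = a2 * K\<^sup>2 + \<bar>\<alpha>\<bar> * (2 * M * K) + \<bar>\<alpha>1\<bar> * M\<^sup>2 + \<bar>\<eta>\<bar> * K + N * K\<^sup>2"
  have T: "0 < T" unfolding T_def using a2 K M N by (intro add_pos_nonneg) auto
  show ?thesis
  proof (intro exI conjI allI impI)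
    show "0 < T / d" using T d by simp
    fix b a c u h uh
    assume h0: "h \<noteq> 0" and h: "\<bar>h\<bar> \<le> 1" and s: "sol b a c u"
      and sh: "sol b (a + \<alpha> * h + \<alpha>1 * h\<^sup>2) (c + \<eta> * h) uh"
    note box = sol_box[OF s] and boxh = sol_box[OF sh]
    define m mh where "m = u 0" and "mh = uh 0"
    define \<delta> where "\<delta> = mh - m"
    define \<beta> where "\<beta> = 2 * b / (p + 2)"
    have \<beta>: "0 \<le> \<beta>" "\<beta> \<le> 1" using two_b_div_le[of b] box by (auto simp: \<beta>_def)
    have m: "0 < m" "m \<le> M" "0 < mh" "mh \<le> M"
      using M(2)[OF s] M(2)[OF sh] sol_pos[OF s] sol_pos[OF sh] by (auto simp: m_def mh_def)
    have \<delta>: "\<bar>\<delta>\<bar> \<le> K * \<bar>h\<bar>" using K(2)[OF h s sh, of 0] by (simp add: \<delta>_def m_def mh_def)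
    have \<delta>2: "\<delta>\<^sup>2 \<le> K\<^sup>2 * h\<^sup>2"
      using power_mono[OF \<delta>, of 2] by (simp add: power_mult_distrib)
    define q where "q = mh powr (- \<rho>) - m powr (- \<rho>) + \<rho> * m powr (- \<rho> - 1) * (mh - m)"
    have q: "\<bar>q\<bar> \<le> N * \<delta>\<^sup>2"
      using powr_neg_taylor[OF exponents(2) u_min_pos sol_ge[OF sh, of 0] sol_ge[OF s, of 0]]
      unfolding q_def N_def \<delta>_def m_def mh_def .
    define X where "X = a * \<delta>\<^sup>2 + \<alpha> * h * (mh\<^sup>2 - m\<^sup>2) + \<alpha>1 * h\<^sup>2 * mh\<^sup>2 + \<eta> * h * \<delta> / 4 - \<beta> * q"
    define D where "D = init_coeff b a c m"
    have D: "d \<le> D" using init_coeff_ge[OF s] by (simp add: d_def D_def m_def)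
    \<comment> \<open>The linear part of the difference of the two initial equations; \<open>X\<close> collects the quadratic remainder.\<close>
    have eq: "\<delta> * D + h * (\<alpha> * m\<^sup>2 + \<eta> / 4 * m) + X = 0"
    proof -
      have e: "mh powr (- \<rho>) = m powr (- \<rho>) - \<rho> * m powr (- \<rho> - 1) * \<delta> + q"
        by (simp add: q_def \<delta>_def)
      have "(a + \<alpha> * h + \<alpha>1 * h\<^sup>2) * mh\<^sup>2 + (c + \<eta> * h) / 4 * mh - 1 / 16 - \<beta> * mh powr (- \<rho>)
         - (a * m\<^sup>2 + c / 4 * m - 1 / 16 - \<beta> * m powr (- \<rho>)) = 0"
        using sol_init[OF s] sol_init[OF sh] by (simp add: m_def mh_def \<beta>_def)
      moreover have "mh = m + \<delta>" by (simp add: \<delta>_def)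
      ultimately show ?thesis
        unfolding e D_def X_def init_coeff_def \<beta>_def[symmetric]
        by (simp add: algebra_simps power2_eq_square add_divide_distrib)
    qed
    have hh: "h\<^sup>2 = \<bar>h\<bar> * \<bar>h\<bar>" by (simp add: power2_eq_square)
    have X: "\<bar>X\<bar> \<le> T * h\<^sup>2"
    proof -
      have "\<bar>a * \<delta>\<^sup>2\<bar> \<le> a2 * (K\<^sup>2 * h\<^sup>2)"
        unfolding abs_mult using box \<delta>2 by (intro mult_mono) auto
      then have x1: "\<bar>a * \<delta>\<^sup>2\<bar> \<le> a2 * K\<^sup>2 * h\<^sup>2" by simp
      have "\<bar>mh\<^sup>2 - m\<^sup>2\<bar> = \<bar>\<delta>\<bar> * \<bar>mh + m\<bar>"
        by (simp add: \<delta>_def power2_eq_square square_diff_square_factored abs_mult mult.commute)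
      also have "\<dots> \<le> (K * \<bar>h\<bar>) * (2 * M)" using \<delta> m K by (intro mult_mono) auto
      finally have "\<bar>\<alpha> * h\<bar> * \<bar>mh\<^sup>2 - m\<^sup>2\<bar> \<le> \<bar>\<alpha> * h\<bar> * ((K * \<bar>h\<bar>) * (2 * M))"
        by (intro mult_left_mono) auto
      also have "\<dots> = \<bar>\<alpha>\<bar> * (2 * M * K) * h\<^sup>2"
        by (simp add: abs_mult power2_eq_square)
      finally have x2: "\<bar>\<alpha> * h * (mh\<^sup>2 - m\<^sup>2)\<bar> \<le> \<bar>\<alpha>\<bar> * (2 * M * K) * h\<^sup>2" by (simp add: abs_mult)
      have x3: "\<bar>\<alpha>1 * h\<^sup>2 * mh\<^sup>2\<bar> \<le> \<bar>\<alpha>1\<bar> * M\<^sup>2 * h\<^sup>2"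
      proof -
        have "\<bar>\<alpha>1\<bar> * h\<^sup>2 * mh\<^sup>2 \<le> \<bar>\<alpha>1\<bar> * h\<^sup>2 * M\<^sup>2"
          using m by (intro mult_left_mono power_mono) auto
        then show ?thesis by (simp add: abs_mult mult_ac)
      qed
      have "\<bar>\<eta> * h * \<delta> / 4\<bar> \<le> \<bar>\<eta>\<bar> * \<bar>h\<bar> * \<bar>\<delta>\<bar>" by (simp add: abs_mult)
      also have "\<dots> \<le> \<bar>\<eta>\<bar> * \<bar>h\<bar> * (K * \<bar>h\<bar>)" using \<delta> by (intro mult_left_mono) auto
      also have "\<dots> = \<bar>\<eta>\<bar> * K * h\<^sup>2" unfolding hh by (simp only: mult_ac)
      finally have x4: "\<bar>\<eta> * h * \<delta> / 4\<bar> \<le> \<bar>\<eta>\<bar> * K * h\<^sup>2" .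
      have "\<bar>\<beta> * q\<bar> \<le> 1 * (N * \<delta>\<^sup>2)" unfolding abs_mult using \<beta> q by (intro mult_mono) auto
      also have "\<dots> \<le> 1 * (N * (K\<^sup>2 * h\<^sup>2))" using \<delta>2 N by (intro mult_left_mono) auto
      finally have x5: "\<bar>\<beta> * q\<bar> \<le> N * K\<^sup>2 * h\<^sup>2" by simp
      show ?thesis
        unfolding X_def T_def distrib_right
        by (intro abs_diff_bound abs_add_bound x1 x2 x3 x4 x5)
    qed
    define Y where "Y = \<delta> / h + (\<alpha> * m\<^sup>2 + \<eta> / 4 * m) / D"
    have "Y * D = - X / h"
    proof -
      have "Y * D = \<delta> * D / h + (\<alpha> * m\<^sup>2 + \<eta> / 4 * m)" 
      proof -
        have "e / D * D = e" for e using D d by simp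
        then show ?thesis unfolding Y_def distrib_right by (simp only: times_divide_eq_left)
      qed
      also have "\<dots> = (\<delta> * D + h * (\<alpha> * m\<^sup>2 + \<eta> / 4 * m)) / h" using h0 by (simp add: add_divide_distrib)
      also have "\<delta> * D + h * (\<alpha> * m\<^sup>2 + \<eta> / 4 * m) = - X" using eq by linarith
      finally show ?thesis .
    qed
    then have "\<bar>Y\<bar> * D = \<bar>X\<bar> / \<bar>h\<bar>" using D d by (metis abs_divide abs_minus_cancel abs_mult abs_of_pos less_le_trans)
    also have "\<dots> \<le> T * h\<^sup>2 / \<bar>h\<bar>" using X by (intro divide_right_mono) auto
    also have "\<dots> = T * \<bar>h\<bar>" unfolding hh using h0 by (simp del: abs_mult_self_eq)
    finally have "\<bar>Y\<bar> * d \<le> T * \<bar>h\<bar>" using mult_left_mono[OF D, of "\<bar>Y\<bar>"] by simp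
    then have "\<bar>Y\<bar> \<le> T / d * \<bar>h\<bar>" using d by (simp add: pos_le_divide_eq)
    then show "\<bar>(uh 0 - u 0) / h + (\<alpha> * (u 0)\<^sup>2 + \<eta> / 4 * u 0) / init_coeff b a c (u 0)\<bar> \<le> T / d * \<bar>h\<bar>"
      by (simp add: Y_def D_def \<delta>_def m_def mh_def)
  qed
qed

text \<open>
  Each quotient \<open>(u_h - u) / h\<close> solves the linearised equation at \<open>u\<close> with the same forcing
  \<open>4 \<alpha> u + \<eta> / 2\<close> up to an error \<open>O(h)\<close>. The error contains \<open>(u_h - u)\<^sup>2\<close>, hence the doubled rate
  \<open>2 \<mu>\<close>; this is harmless because the lemma serves only for pointwise convergence.
\<close>
lemma quotient_cauchy:
  fixes \<alpha> \<alpha>1 \<eta> :: real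
  shows "\<exists>C. \<forall>b a c u h uh k uk x. h \<noteq> 0 \<longrightarrow> \<bar>h\<bar> \<le> 1 \<longrightarrow> k \<noteq> 0 \<longrightarrow> \<bar>k\<bar> \<le> 1 \<longrightarrow> sol b a c u \<longrightarrow>
     sol b (a + \<alpha> * h + \<alpha>1 * h\<^sup>2) (c + \<eta> * h) uh \<longrightarrow> sol b (a + \<alpha> * k + \<alpha>1 * k\<^sup>2) (c + \<eta> * k) uk \<longrightarrow>
     \<bar>(uh x - u x) / h - (uk x - u x) / k\<bar> \<le> C * (\<bar>h\<bar> + \<bar>k\<bar>) * cosh (2 * \<mu> * x)"
proof -
  obtain K where K: "0 < K" "\<And>b a c u h uh x. \<bar>h\<bar> \<le> 1 \<Longrightarrow> sol b a c u \<Longrightarrow>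
     sol b (a + \<alpha> * h + \<alpha>1 * h\<^sup>2) (c + \<eta> * h) uh \<Longrightarrow>
     \<bar>uh x - u x\<bar> \<le> K * \<bar>h\<bar> * cosh (\<mu> * x)" using curve_lipschitz by blast
  obtain M where M: "0 < M" "\<And>b a c u x. sol b a c u \<Longrightarrow> u x \<le> M * cosh (\<mu> * x)"
    using growth_bound by blast
  obtain C0 where C0: "0 < C0" "\<And>b a c u h uh. h \<noteq> 0 \<Longrightarrow> \<bar>h\<bar> \<le> 1 \<Longrightarrow> sol b a c u \<Longrightarrow>
     sol b (a + \<alpha> * h + \<alpha>1 * h\<^sup>2) (c + \<eta> * h) uh \<Longrightarrow>
     \<bar>(uh 0 - u 0) / h + (\<alpha> * (u 0)\<^sup>2 + \<eta> / 4 * u 0) / init_coeff b a c (u 0)\<bar> \<le> C0 * \<bar>h\<bar>"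
    using init_quotient by blast
  define N where "N = r * (r + 1) * u_min powr (- r - 2)"
  have N: "0 \<le> N" using exponents by (simp add: N_def)
  define T where "T = 4 * \<bar>\<alpha>\<bar> * K + 4 * \<bar>\<alpha>1\<bar> * M + \<gamma> * N * K\<^sup>2"
  have T: "0 \<le> T" using K M N exponents by (simp add: T_def)
  have forcing: "\<bar>((4 * (a + \<alpha> * h + \<alpha>1 * h\<^sup>2) * uh x + (c + \<eta> * h) / 2 + b * \<gamma> * uh x powr (- r))
        - (4 * a * u x + c / 2 + b * \<gamma> * u x powr (- r))) / h
      - (4 * a - b * \<gamma> * (r * u x powr (- r - 1))) * ((uh x - u x) / h) - (4 * \<alpha> * u x + \<eta> / 2)\<bar>
      \<le> T * \<bar>h\<bar> * cosh (2 * \<mu> * x)"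
    if h0: "h \<noteq> 0" and h: "\<bar>h\<bar> \<le> 1" and s: "sol b a c u"
      and sh: "sol b (a + \<alpha> * h + \<alpha>1 * h\<^sup>2) (c + \<eta> * h) uh" for b a c u h uh x
  proof -
    note box = sol_box[OF s]
    define q where "q = uh x powr (- r) - u x powr (- r) + r * u x powr (- r - 1) * (uh x - u x)"
    define \<delta> where "\<delta> = uh x - u x"
    define Z where "Z = cosh (\<mu> * x)"
    define Z2 where "Z2 = cosh (2 * \<mu> * x)"
    have Z: "1 \<le> Z" "Z \<le> Z2" "Z\<^sup>2 \<le> Z2"
      using cosh_le_cosh_double[of "\<mu> * x"] by (auto simp: Z_def Z2_def cosh_real_ge_1 mult.assoc)
    have \<delta>: "\<bar>\<delta>\<bar> \<le> K * \<bar>h\<bar> * Z" using K(2)[OF h s sh, of x] by (simp add: \<delta>_def Z_def)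
    have \<delta>2: "\<delta>\<^sup>2 \<le> K\<^sup>2 * h\<^sup>2 * Z\<^sup>2"
      using power_mono[OF \<delta>, of 2] by (simp add: power_mult_distrib)
    have hh: "h\<^sup>2 = \<bar>h\<bar> * \<bar>h\<bar>" by (simp add: power2_eq_square)
    have q: "\<bar>q\<bar> \<le> N * \<delta>\<^sup>2"
      using powr_neg_taylor[of r, OF _ u_min_pos sol_ge[OF sh, of x] sol_ge[OF s, of x]] exponents
      unfolding q_def N_def \<delta>_def by simp
    have e: "uh x powr (- r) = u x powr (- r) - r * u x powr (- r - 1) * \<delta> + q" "uh x = u x + \<delta>"
      by (auto simp: q_def \<delta>_def)
    have "((4 * (a + \<alpha> * h + \<alpha>1 * h\<^sup>2) * uh x + (c + \<eta> * h) / 2 + b * \<gamma> * uh x powr (- r))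
        - (4 * a * u x + c / 2 + b * \<gamma> * u x powr (- r))) / h
      - (4 * a - b * \<gamma> * (r * u x powr (- r - 1))) * (\<delta> / h) - (4 * \<alpha> * u x + \<eta> / 2)
      = 4 * \<alpha> * \<delta> + 4 * \<alpha>1 * h * uh x + b * \<gamma> * (q / h)"
      unfolding e(1) using h0
      by (simp add: e(2) field_simps power2_eq_square)
    moreover have "\<bar>4 * \<alpha> * \<delta> + 4 * \<alpha>1 * h * uh x + b * \<gamma> * (q / h)\<bar> \<le> T * \<bar>h\<bar> * Z2"
    proof -
      have "K * \<bar>h\<bar> * Z \<le> K * \<bar>h\<bar> * Z2" using Z K by (intro mult_left_mono) auto
      then have \<delta>': "\<bar>\<delta>\<bar> \<le> K * \<bar>h\<bar> * Z2" using \<delta> by linarith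
      have "\<bar>4 * \<alpha> * \<delta>\<bar> = 4 * \<bar>\<alpha>\<bar> * \<bar>\<delta>\<bar>" by (simp add: abs_mult)
      also have "\<dots> \<le> 4 * \<bar>\<alpha>\<bar> * (K * \<bar>h\<bar> * Z2)"
        using \<delta>' by (intro mult_left_mono) auto
      finally have x1: "\<bar>4 * \<alpha> * \<delta>\<bar> \<le> 4 * \<bar>\<alpha>\<bar> * K * \<bar>h\<bar> * Z2" by (simp add: mult.assoc)
      have "uh x \<le> M * Z" using M(2)[OF sh] by (simp add: Z_def)
      also have "\<dots> \<le> M * Z2" using Z M by simp
      finally have "\<bar>4 * \<alpha>1 * h\<bar> * \<bar>uh x\<bar> \<le> \<bar>4 * \<alpha>1 * h\<bar> * (M * Z2)"
        using sol_pos[OF sh, of x] by (intro mult_left_mono) auto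
      then have x2: "\<bar>4 * \<alpha>1 * h * uh x\<bar> \<le> 4 * \<bar>\<alpha>1\<bar> * M * \<bar>h\<bar> * Z2" by (simp add: abs_mult mult_ac)
      have "\<bar>q\<bar> / \<bar>h\<bar> \<le> N * (K\<^sup>2 * h\<^sup>2 * Z2) / \<bar>h\<bar>"
      proof (rule divide_right_mono)
        have "N * \<delta>\<^sup>2 \<le> N * (K\<^sup>2 * h\<^sup>2 * Z\<^sup>2)" using \<delta>2 N by (intro mult_left_mono)
        also have "\<dots> \<le> N * (K\<^sup>2 * h\<^sup>2 * Z2)" using Z N by (intro mult_left_mono) auto
        finally show "\<bar>q\<bar> \<le> N * (K\<^sup>2 * h\<^sup>2 * Z2)" using q by simp
      qed simp
      also have "\<dots> = N * K\<^sup>2 * \<bar>h\<bar> * Z2" unfolding hh using h0 by (simp del: abs_mult_self_eq)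
      finally have "b * \<gamma> * (\<bar>q\<bar> / \<bar>h\<bar>) \<le> 1 * \<gamma> * (N * K\<^sup>2 * \<bar>h\<bar> * Z2)"
        using exponents(3) by (intro mult_mono[OF mult_right_mono[OF box(3)]]) auto
      then have x3: "\<bar>b * \<gamma> * (q / h)\<bar> \<le> \<gamma> * N * K\<^sup>2 * \<bar>h\<bar> * Z2"
        using box exponents by (simp add: abs_mult mult.assoc)
      show ?thesis unfolding T_def distrib_right by (intro abs_add_bound x1 x2 x3)
    qed
    ultimately show ?thesis by (simp add: \<delta>_def Z2_def)
  qed
  show ?thesis
  proof (intro exI allI impI)
    fix b a c u h uh k uk x
    assume h: "h \<noteq> 0" "\<bar>h\<bar> \<le> 1" and k: "k \<noteq> 0" "\<bar>k\<bar> \<le> 1" and s: "sol b a c u"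
      and sh: "sol b (a + \<alpha> * h + \<alpha>1 * h\<^sup>2) (c + \<eta> * h) uh"
      and sk: "sol b (a + \<alpha> * k + \<alpha>1 * k\<^sup>2) (c + \<eta> * k) uk"
    note box = sol_box[OF s]
    obtain v where v: "v 0 = 0" "\<And>x. (u has_real_derivative v x) (at x)"
      "\<And>x. (v has_real_derivative 4 * a * u x + c / 2 + b * \<gamma> * u x powr (- r)) (at x)"
      using sol_ode[OF s] by blast
    obtain vh where vh: "vh 0 = 0" "\<And>x. (uh has_real_derivative vh x) (at x)"
      "\<And>x. (vh has_real_derivative 4 * (a + \<alpha> * h + \<alpha>1 * h\<^sup>2) * uh x + (c + \<eta> * h) / 2 + b * \<gamma> * uh x powr (- r)) (at x)"
      using sol_ode[OF sh] by blast
    obtain vk where vk: "vk 0 = 0" "\<And>x. (uk has_real_derivative vk x) (at x)"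
      "\<And>x. (vk has_real_derivative 4 * (a + \<alpha> * k + \<alpha>1 * k\<^sup>2) * uk x + (c + \<eta> * k) / 2 + b * \<gamma> * uk x powr (- r)) (at x)"
      using sol_ode[OF sk] by blast
    define P where "P x = 4 * a - b * \<gamma> * (r * u x powr (- r - 1))" for x
    define Dh where "Dh x = ((4 * (a + \<alpha> * h + \<alpha>1 * h\<^sup>2) * uh x + (c + \<eta> * h) / 2 + b * \<gamma> * uh x powr (- r))
        - (4 * a * u x + c / 2 + b * \<gamma> * u x powr (- r))) / h" for x
    define Dk where "Dk x = ((4 * (a + \<alpha> * k + \<alpha>1 * k\<^sup>2) * uk x + (c + \<eta> * k) / 2 + b * \<gamma> * uk x powr (- r))
        - (4 * a * u x + c / 2 + b * \<gamma> * u x powr (- r))) / k" for x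
    have "\<bar>(uh x - u x) / h - (uk x - u x) / k\<bar>
      \<le> (C0 * (\<bar>h\<bar> + \<bar>k\<bar>) + T * (\<bar>h\<bar> + \<bar>k\<bar>) / ((2 * \<mu>)\<^sup>2 - 4 * a2)) * cosh (2 * \<mu> * x)"
    proof (rule cosh_bound_of_linear_ode[where y = "\<lambda>x. (uh x - u x) / h - (uk x - u x) / k" and P = P
          and y' = "\<lambda>x. (vh x - v x) / h - (vk x - v x) / k" and y'' = "\<lambda>x. Dh x - Dk x"])
      fix x
      show "((\<lambda>x. (uh x - u x) / h - (uk x - u x) / k) has_real_derivative (vh x - v x) / h - (vk x - v x) / k) (at x)"
        by (intro DERIV_diff DERIV_cdivide v vh vk)
      show "((\<lambda>x. (vh x - v x) / h - (vk x - v x) / k) has_real_derivative Dh x - Dk x) (at x)"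
        unfolding Dh_def Dk_def by (intro DERIV_diff DERIV_cdivide v vh vk)
      have e: "Dh x - Dk x - P x * ((uh x - u x) / h - (uk x - u x) / k)
          = (Dh x - P x * ((uh x - u x) / h) - (4 * \<alpha> * u x + \<eta> / 2))
          - (Dk x - P x * ((uk x - u x) / k) - (4 * \<alpha> * u x + \<eta> / 2))"
        by (simp add: right_diff_distrib)
      show "\<bar>Dh x - Dk x - P x * ((uh x - u x) / h - (uk x - u x) / k)\<bar> \<le> T * (\<bar>h\<bar> + \<bar>k\<bar>) * cosh (2 * \<mu> * x)"
      proof -
        have "\<bar>Dh x - P x * ((uh x - u x) / h) - (4 * \<alpha> * u x + \<eta> / 2)\<bar> \<le> T * \<bar>h\<bar> * cosh (2 * \<mu> * x)"
          unfolding Dh_def P_def by (rule forcing[OF h s sh])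
        moreover have "\<bar>Dk x - P x * ((uk x - u x) / k) - (4 * \<alpha> * u x + \<eta> / 2)\<bar> \<le> T * \<bar>k\<bar> * cosh (2 * \<mu> * x)"
          unfolding Dk_def P_def by (rule forcing[OF k s sk])
        ultimately show ?thesis unfolding e distrib_left distrib_right by (rule abs_diff_bound)
      qed
      have "b * \<gamma> * (r * u x powr (- r - 1)) \<le> b * \<gamma> * (r * u_min powr (- r - 1))"
        using box exponents by (intro mult_left_mono powr_le_u_min[OF s]) auto
      also have "\<dots> \<le> 4 * a1" using b_max_small box by simp
      finally show "0 \<le> P x" using box by (simp add: P_def)
      have "0 \<le> b * \<gamma> * (r * u x powr (- r - 1))" using box exponents by simp
      then show "P x \<le> 4 * a2" using box by (simp add: P_def)
    next
      show "4 * a2 < (2 * \<mu>)\<^sup>2" using \<mu> a2 by (simp add: power_mult_distrib)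
      show "\<bar>(uh 0 - u 0) / h - (uk 0 - u 0) / k\<bar> \<le> C0 * (\<bar>h\<bar> + \<bar>k\<bar>)"
        using abs_diff_bound[OF C0(2)[OF h s sh] C0(2)[OF k s sk]]
        by (simp only: add_diff_cancel_right distrib_left)
    qed (use v vh vk in auto)
    then show "\<bar>(uh x - u x) / h - (uk x - u x) / k\<bar>
      \<le> (C0 + T / ((2 * \<mu>)\<^sup>2 - 4 * a2)) * (\<bar>h\<bar> + \<bar>k\<bar>) * cosh (2 * \<mu> * x)"
      by (simp only: distrib_right times_divide_eq_left)
  qed
qed

section \<open>Dependence of the parameter derivatives on b\<close>
lemma init_slope_b_lipschitz:
  fixes \<alpha> \<eta> :: real
  shows "\<exists>C>0. \<forall>b a c u w. sol b a c u \<longrightarrow> sol 0 a c w \<longrightarrow>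
     \<bar>(\<alpha> * (u 0)\<^sup>2 + \<eta> / 4 * u 0) / init_coeff b a c (u 0)
      - (\<alpha> * (w 0)\<^sup>2 + \<eta> / 4 * w 0) / init_coeff 0 a c (w 0)\<bar> \<le> C * b"
proof -
  obtain K where K: "0 < K" "\<And>b a c u b' a' c' u'. sol b a c u \<Longrightarrow> sol b' a' c' u' \<Longrightarrow>
     \<bar>u 0 - u' 0\<bar> \<le> K * (\<bar>b - b'\<bar> + \<bar>a - a'\<bar> + \<bar>c - c'\<bar>)" using init_lipschitz by blast
  obtain M where M: "0 < M" "\<And>b a c u. sol b a c u \<Longrightarrow> u 0 \<le> M" using init_bound by blast
  define d where "d = 2 * a1 * u_min"
  have d: "0 < d" using a1 u_min_pos by (simp add: d_def)
  define N where "N = \<rho> * u_min powr (- \<rho> - 1)"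
  have N: "0 \<le> N" using exponents by (simp add: N_def)
  define T1 where "T1 = \<bar>\<alpha>\<bar> * (2 * M * K) + \<bar>\<eta>\<bar> * K"
  define T2 where "T2 = \<bar>\<alpha>\<bar> * M\<^sup>2 + \<bar>\<eta>\<bar> * M"
  define T3 where "T3 = 2 * a2 * K + N"
  have T: "0 \<le> T1" "0 \<le> T2" "0 \<le> T3" using K M N a2 by (auto simp: T1_def T2_def T3_def)
  show ?thesis
  proof (intro exI conjI allI impI)
    show "0 < T1 / d + T2 * T3 / d\<^sup>2 + 1" using T d by (simp add: add_nonneg_pos)
    fix b a c u w assume s: "sol b a c u" and s0: "sol 0 a c w"
    note box = sol_box[OF s]
    define m m' where "m = u 0" and "m' = w 0"
    define D D' where "D = init_coeff b a c m" and "D' = init_coeff 0 a c m'"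
    define n n' where "n = \<alpha> * m\<^sup>2 + \<eta> / 4 * m" and "n' = \<alpha> * m'\<^sup>2 + \<eta> / 4 * m'"
    have D: "d \<le> D" "d \<le> D'"
      using init_coeff_ge[OF s] init_coeff_ge[OF s0] by (auto simp: d_def D_def D'_def m_def m'_def)
    have m: "0 < m" "m \<le> M" "0 < m'" "m' \<le> M"
      using M(2)[OF s] M(2)[OF s0] sol_pos[OF s] sol_pos[OF s0] by (auto simp: m_def m'_def)
    have mm: "\<bar>m - m'\<bar> \<le> K * b" using K(2)[OF s s0] box by (simp add: m_def m'_def)
    have n: "\<bar>n - n'\<bar> \<le> T1 * b"
    proof -
      have "\<bar>m\<^sup>2 - m'\<^sup>2\<bar> = \<bar>m - m'\<bar> * \<bar>m + m'\<bar>"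
        by (simp add: power2_eq_square square_diff_square_factored abs_mult mult.commute)
      also have "\<dots> \<le> (K * b) * (2 * M)" using mm m K box by (intro mult_mono) auto
      finally have "\<bar>\<alpha>\<bar> * \<bar>m\<^sup>2 - m'\<^sup>2\<bar> \<le> \<bar>\<alpha>\<bar> * ((K * b) * (2 * M))" by (intro mult_left_mono) auto
      then have "\<bar>\<alpha> * (m\<^sup>2 - m'\<^sup>2)\<bar> \<le> \<bar>\<alpha>\<bar> * (2 * M * K) * b" by (simp add: abs_mult mult_ac)
      moreover have "\<bar>\<eta> / 4 * (m - m')\<bar> \<le> \<bar>\<eta>\<bar> * (K * b)"
        unfolding abs_mult using mm by (intro mult_mono) auto
      then have "\<bar>\<eta> / 4 * (m - m')\<bar> \<le> \<bar>\<eta>\<bar> * K * b" by (simp only: mult.assoc)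
      ultimately have "\<bar>\<alpha> * (m\<^sup>2 - m'\<^sup>2) + \<eta> / 4 * (m - m')\<bar> \<le> T1 * b"
        unfolding T1_def distrib_right by (rule abs_add_bound)
      moreover have "n - n' = \<alpha> * (m\<^sup>2 - m'\<^sup>2) + \<eta> / 4 * (m - m')"
        by (simp add: n_def n'_def algebra_simps diff_divide_distrib)
      ultimately show ?thesis by (simp only:)
    qed
    have n': "\<bar>n'\<bar> \<le> T2"
    proof -
      have "\<bar>\<alpha> * m'\<^sup>2\<bar> \<le> \<bar>\<alpha>\<bar> * M\<^sup>2" unfolding abs_mult using m by (intro mult_mono) (auto simp: power_mono)
      moreover have "\<bar>\<eta> / 4 * m'\<bar> \<le> \<bar>\<eta>\<bar> * M" unfolding abs_mult using m by (intro mult_mono) auto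
      ultimately show ?thesis unfolding n'_def T2_def by linarith
    qed
    have DD: "\<bar>D - D'\<bar> \<le> T3 * b"
    proof -
      have "\<bar>2 * a * (m - m')\<bar> \<le> 2 * a2 * (K * b)"
        unfolding abs_mult using mm box by (intro mult_mono) auto
      moreover have "\<rho> * m powr (- \<rho> - 1) \<le> N"
        unfolding N_def m_def using exponents powr_le_u_min[OF s, of "- \<rho> - 1" 0] by (intro mult_left_mono) auto
      then have "2 * b / (p + 2) * (\<rho> * m powr (- \<rho> - 1)) \<le> b * N"
        using two_b_div_le[of b] box exponents by (intro mult_mono) auto
      moreover have "0 \<le> 2 * b / (p + 2) * (\<rho> * m powr (- \<rho> - 1))" using box exponents by simp
      moreover have "D - D' = 2 * a * (m - m') + 2 * b / (p + 2) * (\<rho> * m powr (- \<rho> - 1))"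
        by (simp add: D_def D'_def init_coeff_def algebra_simps)
      moreover have "T3 * b = 2 * a2 * (K * b) + b * N" by (simp add: T3_def algebra_simps)
      ultimately show ?thesis by linarith
    qed
    have "n / D - n' / D' = (n - n') / D - n' * (D - D') / (D * D')"
      using D d by (simp add: field_simps)
    also have "\<bar>\<dots>\<bar> \<le> \<bar>n - n'\<bar> / \<bar>D\<bar> + \<bar>n'\<bar> * \<bar>D - D'\<bar> / (\<bar>D\<bar> * \<bar>D'\<bar>)"
      by (rule order_trans[OF abs_triangle_ineq4]) (simp add: abs_mult)
    also have "\<dots> \<le> T1 * b / d + T2 * (T3 * b) / (d * d)"
    proof (rule add_mono)
      show "\<bar>n - n'\<bar> / \<bar>D\<bar> \<le> T1 * b / d"
        using T(1) box(1) D(1) d by (intro frac_le[OF _ n]) auto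
      have "\<bar>n'\<bar> * \<bar>D - D'\<bar> \<le> T2 * (T3 * b)" using T(2) by (intro mult_mono[OF n' DD]) auto
      moreover have "d * d \<le> \<bar>D\<bar> * \<bar>D'\<bar>" using D d by (intro mult_mono) auto
      ultimately show "\<bar>n'\<bar> * \<bar>D - D'\<bar> / (\<bar>D\<bar> * \<bar>D'\<bar>) \<le> T2 * (T3 * b) / (d * d)"
        using T(2,3) box(1) d by (intro frac_le) auto
    qed
    also have "\<dots> \<le> (T1 / d + T2 * T3 / d\<^sup>2 + 1) * b"
      using box by (simp add: algebra_simps power2_eq_square)
    finally show "\<bar>(\<alpha> * (u 0)\<^sup>2 + \<eta> / 4 * u 0) / init_coeff b a c (u 0)
      - (\<alpha> * (w 0)\<^sup>2 + \<eta> / 4 * w 0) / init_coeff 0 a c (w 0)\<bar> \<le> (T1 / d + T2 * T3 / d\<^sup>2 + 1) * b"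
      unfolding n_def n'_def D_def D'_def m_def m'_def .
  qed
qed

text \<open>
  Quotients for \<open>b\<close> and for \<open>0\<close> are compared at equal \<open>h\<close>. Then the forcing is a multiple of
  \<open>u_h - w_h = O(b)\<close> plus the quotient of the nonlinear term, which carries the factor \<open>b\<close>. The error
  \<open>O(\<bar>h\<bar>)\<close> comes from the initial values.
\<close>
lemma quotient_b_lipschitz:
  fixes \<alpha> \<alpha>1 \<eta> :: real
  shows "\<exists>C>0. \<forall>b a c u h uh w wh x. h \<noteq> 0 \<longrightarrow> \<bar>h\<bar> \<le> 1 \<longrightarrow> sol b a c u \<longrightarrow> sol 0 a c w \<longrightarrow>
     sol b (a + \<alpha> * h + \<alpha>1 * h\<^sup>2) (c + \<eta> * h) uh \<longrightarrow> sol 0 (a + \<alpha> * h + \<alpha>1 * h\<^sup>2) (c + \<eta> * h) wh \<longrightarrow>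
     \<bar>(uh x - u x) / h - (wh x - w x) / h\<bar> \<le> C * (b + \<bar>h\<bar>) * cosh (\<mu> * x)"
proof -
  obtain K where K: "0 < K" "\<And>b a c u b' a' c' u' x. sol b a c u \<Longrightarrow> sol b' a' c' u' \<Longrightarrow>
     \<bar>u x - u' x\<bar> \<le> K * (\<bar>b - b'\<bar> + \<bar>a - a'\<bar> + \<bar>c - c'\<bar>) * cosh (\<mu> * x)" using sol_lipschitz by blast
  obtain K1 where K1: "0 < K1" "\<And>b a c u h uh x. \<bar>h\<bar> \<le> 1 \<Longrightarrow> sol b a c u \<Longrightarrow>
     sol b (a + \<alpha> * h + \<alpha>1 * h\<^sup>2) (c + \<eta> * h) uh \<Longrightarrow>
     \<bar>uh x - u x\<bar> \<le> K1 * \<bar>h\<bar> * cosh (\<mu> * x)" using curve_lipschitz by blast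
  obtain C0 where C0: "0 < C0" "\<And>b a c u h uh. h \<noteq> 0 \<Longrightarrow> \<bar>h\<bar> \<le> 1 \<Longrightarrow> sol b a c u \<Longrightarrow>
     sol b (a + \<alpha> * h + \<alpha>1 * h\<^sup>2) (c + \<eta> * h) uh \<Longrightarrow>
     \<bar>(uh 0 - u 0) / h + (\<alpha> * (u 0)\<^sup>2 + \<eta> / 4 * u 0) / init_coeff b a c (u 0)\<bar> \<le> C0 * \<bar>h\<bar>"
    using init_quotient by blast
  obtain C1 where C1: "0 < C1" "\<And>b a c u w. sol b a c u \<Longrightarrow> sol 0 a c w \<Longrightarrow>
     \<bar>(\<alpha> * (u 0)\<^sup>2 + \<eta> / 4 * u 0) / init_coeff b a c (u 0)
      - (\<alpha> * (w 0)\<^sup>2 + \<eta> / 4 * w 0) / init_coeff 0 a c (w 0)\<bar> \<le> C1 * b"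
    using init_slope_b_lipschitz by blast
  define N where "N = r * u_min powr (- r - 1)"
  have N: "0 \<le> N" using exponents by (simp add: N_def)
  define T where "T = 4 * (\<bar>\<alpha>\<bar> + \<bar>\<alpha>1\<bar>) * K + \<gamma> * N * K1"
  have T: "0 \<le> T" using K K1 N exponents by (simp add: T_def)
  define B where "B = C1 + 2 * C0"
  show ?thesis
  proof (intro exI conjI allI impI)
    show "0 < B + T / (\<mu>\<^sup>2 - 4 * a2)" using T C0 C1 \<mu> by (simp add: B_def add_pos_nonneg)
    fix b a c u h uh w wh x
    assume h: "h \<noteq> 0" "\<bar>h\<bar> \<le> 1" and s: "sol b a c u" and t: "sol 0 a c w"
      and sh: "sol b (a + \<alpha> * h + \<alpha>1 * h\<^sup>2) (c + \<eta> * h) uh"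
      and th: "sol 0 (a + \<alpha> * h + \<alpha>1 * h\<^sup>2) (c + \<eta> * h) wh"
    note box = sol_box[OF s]
    obtain v where v: "v 0 = 0" "\<And>x. (u has_real_derivative v x) (at x)"
      "\<And>x. (v has_real_derivative 4 * a * u x + c / 2 + b * \<gamma> * u x powr (- r)) (at x)"
      using sol_ode[OF s] by blast
    obtain z where z: "z 0 = 0" "\<And>x. (w has_real_derivative z x) (at x)"
      "\<And>x. (z has_real_derivative 4 * a * w x + c / 2 + 0 * \<gamma> * w x powr (- r)) (at x)"
      using sol_ode[OF t] by blast
    define ah where "ah = a + \<alpha> * h + \<alpha>1 * h\<^sup>2"
    define ch where "ch = c + \<eta> * h"
    obtain vh where vh: "vh 0 = 0" "\<And>x. (uh has_real_derivative vh x) (at x)"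
      "\<And>x. (vh has_real_derivative 4 * ah * uh x + ch / 2 + b * \<gamma> * uh x powr (- r)) (at x)"
      using sol_ode[OF sh] unfolding ah_def ch_def by blast
    obtain zh where zh: "zh 0 = 0" "\<And>x. (wh has_real_derivative zh x) (at x)"
      "\<And>x. (zh has_real_derivative 4 * ah * wh x + ch / 2 + 0 * \<gamma> * wh x powr (- r)) (at x)"
      using sol_ode[OF th] unfolding ah_def ch_def by blast
    have "\<bar>(uh x - u x) / h - (wh x - w x) / h\<bar>
      \<le> (B * (b + \<bar>h\<bar>) + T * (b + \<bar>h\<bar>) / (\<mu>\<^sup>2 - 4 * a2)) * cosh (\<mu> * x)"
    proof (rule cosh_bound_of_linear_ode[where y = "\<lambda>x. (uh x - u x) / h - (wh x - w x) / h" and P = "\<lambda>_. 4 * a"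
          and y' = "\<lambda>x. (vh x - v x) / h - (zh x - z x) / h"
          and y'' = "\<lambda>x. ((4 * ah * uh x + ch / 2 + b * \<gamma> * uh x powr (- r)) - (4 * a * u x + c / 2 + b * \<gamma> * u x powr (- r))) / h
            - ((4 * ah * wh x + ch / 2 + 0 * \<gamma> * wh x powr (- r)) - (4 * a * w x + c / 2 + 0 * \<gamma> * w x powr (- r))) / h"])
      fix x
      show "((\<lambda>x. (uh x - u x) / h - (wh x - w x) / h) has_real_derivative (vh x - v x) / h - (zh x - z x) / h) (at x)"
        by (intro DERIV_diff DERIV_cdivide v vh z zh)
      show "((\<lambda>x. (vh x - v x) / h - (zh x - z x) / h) has_real_derivative
            ((4 * ah * uh x + ch / 2 + b * \<gamma> * uh x powr (- r)) - (4 * a * u x + c / 2 + b * \<gamma> * u x powr (- r))) / h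
            - ((4 * ah * wh x + ch / 2 + 0 * \<gamma> * wh x powr (- r)) - (4 * a * w x + c / 2 + 0 * \<gamma> * w x powr (- r))) / h) (at x)"
        by (intro DERIV_diff DERIV_cdivide v vh z zh)
      define Z where "Z = cosh (\<mu> * x)"
      have Z: "0 \<le> Z" by (simp add: Z_def)
      define \<beta> where "\<beta> = \<alpha> + \<alpha>1 * h"
      have ah: "ah = a + h * \<beta>" by (simp add: ah_def \<beta>_def algebra_simps power2_eq_square)
      have "((4 * ah * uh x + ch / 2 + b * \<gamma> * uh x powr (- r)) - (4 * a * u x + c / 2 + b * \<gamma> * u x powr (- r))) / h
            - ((4 * ah * wh x + ch / 2 + 0 * \<gamma> * wh x powr (- r)) - (4 * a * w x + c / 2 + 0 * \<gamma> * w x powr (- r))) / h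
           - 4 * a * ((uh x - u x) / h - (wh x - w x) / h)
          = 4 * \<beta> * (uh x - wh x) + b * \<gamma> * ((uh x powr (- r) - u x powr (- r)) / h)"
        unfolding ah using h(1) by (simp add: diff_divide_distrib add_divide_distrib algebra_simps)
      moreover have "\<bar>4 * \<beta> * (uh x - wh x) + b * \<gamma> * ((uh x powr (- r) - u x powr (- r)) / h)\<bar> \<le> T * (b + \<bar>h\<bar>) * Z"
      proof -
        have "\<bar>\<beta>\<bar> \<le> \<bar>\<alpha>\<bar> + \<bar>\<alpha>1\<bar>"
          using abs_triangle_ineq[of \<alpha> "\<alpha>1 * h"] mult_left_mono[OF h(2), of "\<bar>\<alpha>1\<bar>"]
          by (simp add: \<beta>_def abs_mult)
        moreover have "\<bar>uh x - wh x\<bar> \<le> K * b * Z"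
          using K(2)[OF sh th, of x] box(1) by (simp add: Z_def)
        ultimately have "4 * \<bar>\<beta>\<bar> * \<bar>uh x - wh x\<bar> \<le> 4 * (\<bar>\<alpha>\<bar> + \<bar>\<alpha>1\<bar>) * (K * b * Z)"
          by (intro mult_mono) auto
        then have x1: "\<bar>4 * \<beta> * (uh x - wh x)\<bar> \<le> 4 * (\<bar>\<alpha>\<bar> + \<bar>\<alpha>1\<bar>) * K * b * Z" by (simp add: abs_mult mult.assoc)
        have "\<bar>uh x powr (- r) - u x powr (- r)\<bar> \<le> N * \<bar>uh x - u x\<bar>"
          unfolding N_def using exponents by (intro powr_neg_lipschitz u_min_pos sol_ge[OF s] sol_ge[OF sh]) auto
        also have "\<dots> \<le> N * (K1 * \<bar>h\<bar> * Z)"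
          using K1(2)[OF h(2) s sh, of x] N unfolding Z_def by (intro mult_left_mono) auto
        finally have "\<bar>uh x powr (- r) - u x powr (- r)\<bar> / \<bar>h\<bar> \<le> N * K1 * Z"
          using h(1) by (simp add: divide_le_eq mult_ac)
        then have "b * \<gamma> * (\<bar>uh x powr (- r) - u x powr (- r)\<bar> / \<bar>h\<bar>) \<le> b * \<gamma> * (N * K1 * Z)"
          using box exponents by (intro mult_left_mono) auto
        then have x2: "\<bar>b * \<gamma> * ((uh x powr (- r) - u x powr (- r)) / h)\<bar> \<le> \<gamma> * N * K1 * b * Z"
          using box exponents by (simp add: abs_mult mult_ac)
        have "\<bar>4 * \<beta> * (uh x - wh x) + b * \<gamma> * ((uh x powr (- r) - u x powr (- r)) / h)\<bar> \<le> T * b * Z"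
        proof -
          have "T * b * Z = 4 * (\<bar>\<alpha>\<bar> + \<bar>\<alpha>1\<bar>) * K * b * Z + \<gamma> * N * K1 * b * Z"
            by (simp add: T_def algebra_simps)
          then show ?thesis using abs_add_bound[OF x1 x2] by (simp only:)
        qed
        also have "\<dots> \<le> T * (b + \<bar>h\<bar>) * Z" using T Z by (intro mult_right_mono mult_left_mono) auto
        finally show ?thesis .
      qed
      ultimately show "\<bar>((4 * ah * uh x + ch / 2 + b * \<gamma> * uh x powr (- r)) - (4 * a * u x + c / 2 + b * \<gamma> * u x powr (- r))) / h
            - ((4 * ah * wh x + ch / 2 + 0 * \<gamma> * wh x powr (- r)) - (4 * a * w x + c / 2 + 0 * \<gamma> * w x powr (- r))) / h
           - 4 * a * ((uh x - u x) / h - (wh x - w x) / h)\<bar> \<le> T * (b + \<bar>h\<bar>) * cosh (\<mu> * x)"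
        unfolding Z_def by (simp only:)
    next
      have triangle: "\<bar>s - s'\<bar> \<le> t" if "\<bar>s + e\<bar> \<le> y" "\<bar>s' + e'\<bar> \<le> y" "\<bar>e - e'\<bar> \<le> z" "z + 2 * y \<le> t"
        for s s' e e' y z t :: real
        using that by linarith
      have "C1 * b + 2 * (C0 * \<bar>h\<bar>) \<le> B * (b + \<bar>h\<bar>)"
        using C0 C1 box unfolding B_def by (simp add: algebra_simps)
      then show "\<bar>(uh 0 - u 0) / h - (wh 0 - w 0) / h\<bar> \<le> B * (b + \<bar>h\<bar>)"
        by (rule triangle[OF C0(2)[OF h s sh] C0(2)[OF h t th] C1(2)[OF s t]])
    qed (use v vh z zh box \<mu> in auto)
    then show "\<bar>(uh x - u x) / h - (wh x - w x) / h\<bar> \<le> (B + T / (\<mu>\<^sup>2 - 4 * a2)) * (b + \<bar>h\<bar>) * cosh (\<mu> * x)"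
      by (simp only: distrib_right times_divide_eq_left)
  qed
qed

text \<open>
  The limits of the difference quotients inherit their bounds.
\<close>
lemma curve_derivative:
  fixes a c \<alpha> \<alpha>1 \<eta> h0 :: real and U :: "real \<Rightarrow> real \<Rightarrow> real \<Rightarrow> real"
  assumes h0: "0 < h0" "h0 \<le> 1"
    and sol: "\<And>b h. 0 \<le> b \<Longrightarrow> b \<le> b_max \<Longrightarrow> \<bar>h\<bar> < h0 \<Longrightarrow>
      sol b (a + \<alpha> * h + \<alpha>1 * h\<^sup>2) (c + \<eta> * h) (U b h)"
  shows "\<exists>V C. 0 < C \<and> (\<forall>b. 0 \<le> b \<longrightarrow> b \<le> b_max \<longrightarrow> V b \<in> borel_measurable lborel \<and> (\<forall>x.
      ((\<lambda>h. U b h x) has_real_derivative V b x) (at 0) \<and>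
      \<bar>V b x\<bar> \<le> C * cosh (\<mu> * x) \<and> \<bar>V b x - V 0 x\<bar> \<le> C * b * cosh (\<mu> * x) \<and>
      \<bar>U b 0 x - U 0 0 x\<bar> \<le> C * b * cosh (\<mu> * x)))"
proof -
  obtain K where K: "0 < K" "\<And>b a c u b' a' c' u' x. sol b a c u \<Longrightarrow> sol b' a' c' u' \<Longrightarrow>
     \<bar>u x - u' x\<bar> \<le> K * (\<bar>b - b'\<bar> + \<bar>a - a'\<bar> + \<bar>c - c'\<bar>) * cosh (\<mu> * x)" using sol_lipschitz by blast
  obtain K1 where K1: "0 < K1" "\<And>b a c u h uh x. \<bar>h\<bar> \<le> 1 \<Longrightarrow> sol b a c u \<Longrightarrow>
     sol b (a + \<alpha> * h + \<alpha>1 * h\<^sup>2) (c + \<eta> * h) uh \<Longrightarrow>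
     \<bar>uh x - u x\<bar> \<le> K1 * \<bar>h\<bar> * cosh (\<mu> * x)" using curve_lipschitz by blast
  obtain C2 where C2: "\<And>b a c u h uh k uk x. h \<noteq> 0 \<Longrightarrow> \<bar>h\<bar> \<le> 1 \<Longrightarrow> k \<noteq> 0 \<Longrightarrow> \<bar>k\<bar> \<le> 1 \<Longrightarrow> sol b a c u \<Longrightarrow>
     sol b (a + \<alpha> * h + \<alpha>1 * h\<^sup>2) (c + \<eta> * h) uh \<Longrightarrow> sol b (a + \<alpha> * k + \<alpha>1 * k\<^sup>2) (c + \<eta> * k) uk \<Longrightarrow>
     \<bar>(uh x - u x) / h - (uk x - u x) / k\<bar> \<le> C2 * (\<bar>h\<bar> + \<bar>k\<bar>) * cosh (2 * \<mu> * x)"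
    using quotient_cauchy by blast
  obtain C3 where C3: "0 < C3" "\<And>b a c u h uh w wh x. h \<noteq> 0 \<Longrightarrow> \<bar>h\<bar> \<le> 1 \<Longrightarrow> sol b a c u \<Longrightarrow> sol 0 a c w \<Longrightarrow>
     sol b (a + \<alpha> * h + \<alpha>1 * h\<^sup>2) (c + \<eta> * h) uh \<Longrightarrow> sol 0 (a + \<alpha> * h + \<alpha>1 * h\<^sup>2) (c + \<eta> * h) wh \<Longrightarrow>
     \<bar>(uh x - u x) / h - (wh x - w x) / h\<bar> \<le> C3 * (b + \<bar>h\<bar>) * cosh (\<mu> * x)"
    using quotient_b_lipschitz by blast
  have sol0: "sol b a c (U b 0)" if "0 \<le> b" "b \<le> b_max" for b using sol[OF that, of 0] h0 by simp
  define Q where "Q b h x = (U b h x - U b 0 x) / h" for b h x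
  have near: "\<forall>\<^sub>F h in at 0. h \<noteq> 0 \<and> \<bar>h\<bar> < h0"
    unfolding eventually_at using h0 by (intro exI[of _ h0]) auto
  have "\<exists>l. ((\<lambda>h. Q b h x) \<longlongrightarrow> l) (at 0)" if b: "0 \<le> b" "b \<le> b_max" for b x
  proof (rule convergent_at_zero_of_cauchy_rate[OF h0(1), where C = "C2 * cosh (2 * \<mu> * x)"])
    fix h k assume "h \<noteq> 0" "k \<noteq> 0" "\<bar>h\<bar> < h0" "\<bar>k\<bar> < h0"
    then have "\<bar>Q b h x - Q b k x\<bar> \<le> C2 * (\<bar>h\<bar> + \<bar>k\<bar>) * cosh (2 * \<mu> * x)"
      unfolding Q_def using h0 by (intro C2[OF _ _ _ _ sol0[OF b] sol[OF b] sol[OF b]]) auto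
    then show "\<bar>Q b h x - Q b k x\<bar> \<le> C2 * cosh (2 * \<mu> * x) * (\<bar>h\<bar> + \<bar>k\<bar>)" by (simp add: mult_ac)
  qed
  then obtain V where V: "\<And>b x. 0 \<le> b \<Longrightarrow> b \<le> b_max \<Longrightarrow> ((\<lambda>h. Q b h x) \<longlongrightarrow> V b x) (at 0)"
    by metis
  define C where "C = K + K1 + C3"
  show ?thesis
  proof (intro exI[of _ V] exI[of _ C] conjI allI impI)
    show "0 < C" using K K1 C3 by (simp add: C_def)
    fix b assume b: "0 \<le> b" "b \<le> b_max"
    have zero: "0 \<le> (0::real)" "0 \<le> b_max" using b_max_pos by auto
    define k where "k n = h0 / (real n + 2)" for n :: nat
    have k: "k n \<noteq> 0" "\<bar>k n\<bar> < h0" for n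
    proof -
      show "k n \<noteq> 0" using h0 by (simp add: k_def)
      have "h0 * 1 < h0 * (real n + 2)" using h0 by (intro mult_strict_left_mono) auto
      then show "\<bar>k n\<bar> < h0" using h0 by (simp add: k_def pos_divide_less_eq)
    qed
    have "k \<longlonglongrightarrow> 0" unfolding k_def by real_asymp
    then have kat: "filterlim k (at 0) sequentially"
      using k by (simp add: filterlim_at)
    show "V b \<in> borel_measurable lborel"
    proof (rule borel_measurable_LIMSEQ_real)
      show "(\<lambda>n. Q b (k n) x) \<longlonglongrightarrow> V b x" for x by (rule filterlim_compose[OF V[OF b] kat])
      have m: "U b h \<in> borel_measurable lborel" if h: "\<bar>h\<bar> < h0" for h
        by (rule sol_measurable[OF sol[OF b h]])
      show "(\<lambda>x. Q b (k n) x) \<in> borel_measurable lborel" for n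
        unfolding Q_def using m[of 0] m[OF k(2)[of n]] h0 by simp
    qed
    fix x
    show "((\<lambda>h. U b h x) has_real_derivative V b x) (at 0)"
      using V[OF b] by (simp add: DERIV_def Q_def)
    show "\<bar>V b x\<bar> \<le> C * cosh (\<mu> * x)"
    proof -
      have "\<bar>V b x\<bar> \<le> K1 * cosh (\<mu> * x)"
      proof (rule tendsto_upperbound[OF tendsto_rabs[OF V[OF b]]])
        show "\<forall>\<^sub>F h in at 0. \<bar>Q b h x\<bar> \<le> K1 * cosh (\<mu> * x)"
          using near
        proof eventually_elim
          case (elim h)
          then have "\<bar>U b h x - U b 0 x\<bar> \<le> K1 * \<bar>h\<bar> * cosh (\<mu> * x)"
            using h0 by (intro K1(2)[OF _ sol0[OF b] sol[OF b]]) auto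
          then show ?case using elim by (simp add: Q_def divide_le_eq mult_ac)
        qed
      qed simp
      also have "\<dots> \<le> C * cosh (\<mu> * x)" using K C3 by (intro mult_right_mono) (auto simp: C_def)
      finally show ?thesis .
    qed
    show "\<bar>V b x - V 0 x\<bar> \<le> C * b * cosh (\<mu> * x)"
    proof -
      have "\<bar>V b x - V 0 x\<bar> \<le> C3 * (b + \<bar>0\<bar>) * cosh (\<mu> * x)"
      proof (rule tendsto_le)
        show "((\<lambda>h. \<bar>Q b h x - Q 0 h x\<bar>) \<longlongrightarrow> \<bar>V b x - V 0 x\<bar>) (at 0)"
          by (intro tendsto_intros V b zero)
        show "((\<lambda>h. C3 * (b + \<bar>h\<bar>) * cosh (\<mu> * x)) \<longlongrightarrow> C3 * (b + \<bar>0\<bar>) * cosh (\<mu> * x)) (at 0)"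
          by (intro tendsto_intros)
        show "\<forall>\<^sub>F h in at 0. \<bar>Q b h x - Q 0 h x\<bar> \<le> C3 * (b + \<bar>h\<bar>) * cosh (\<mu> * x)"
          using near
        proof eventually_elim
          case (elim h)
          then show ?case
            unfolding Q_def using h0
            by (intro C3(2)[OF _ _ sol0[OF b] sol0[OF zero] sol[OF b] sol[OF zero]]) auto
        qed
      qed simp
      also have "\<dots> = C3 * b * cosh (\<mu> * x)" by simp
      also have "\<dots> \<le> C * b * cosh (\<mu> * x)" using K K1 b by (intro mult_right_mono) (auto simp: C_def)
      finally show ?thesis .
    qed
    show "\<bar>U b 0 x - U 0 0 x\<bar> \<le> C * b * cosh (\<mu> * x)"
    proof -
      have "\<bar>U b 0 x - U 0 0 x\<bar> \<le> K * b * cosh (\<mu> * x)"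
        using K(2)[OF sol0[OF b] sol0[OF zero], of x] b by simp
      also have "\<dots> \<le> C * b * cosh (\<mu> * x)" using K1 C3 b by (intro mult_right_mono) (auto simp: C_def)
      finally show ?thesis .
    qed
  qed
qed

end

section \<open>Decay of the differences of profiles\<close>
lemma exp_abs_bounds_cosh:
  fixes t :: real
  shows "exp \<bar>t\<bar> / 2 \<le> cosh t" "cosh t \<le> exp \<bar>t\<bar>"
proof -
  show "exp \<bar>t\<bar> / 2 \<le> cosh t" "cosh t \<le> exp \<bar>t\<bar>"
    by (cases "0 \<le> t"; simp add: cosh_def field_simps)+
qed

text \<open>
  Write \<open>\<kappa> = 2 \<surd>a\<close>. Going back to \<open>\<phi> = u^(-1/2)\<close>, whose parameter derivative is \<open>- u^(-3/2) V / 2\<close>,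
  gains a factor \<open>e^(-3 \<kappa> \<bar>x\<bar> / 2)\<close> against one factor \<open>cosh (\<mu> x)\<close>, or \<open>e^(-5 \<kappa> \<bar>x\<bar> / 2)\<close>
  against two. With \<open>\<mu> \<le> 9 \<kappa> / 8\<close> both products decay at least like \<open>e^(-\<kappa> \<bar>x\<bar> / 4)\<close>.
\<close>
lemma (in parameter_box) profile_curve_estimate:
  fixes a c \<alpha> \<alpha>1 \<eta> h0 :: real and \<Phi> :: "real \<Rightarrow> real \<Rightarrow> real \<Rightarrow> real"
  assumes h0: "0 < h0" "h0 \<le> 1" and \<mu>_bounds: "0 \<le> \<mu>" "4 * \<mu> \<le> 9 * sqrt a"
    and pos: "\<And>b h x. 0 \<le> b \<Longrightarrow> b \<le> b_max \<Longrightarrow> \<bar>h\<bar> < h0 \<Longrightarrow> 0 < \<Phi> b h x"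
    and sol: "\<And>b h. 0 \<le> b \<Longrightarrow> b \<le> b_max \<Longrightarrow> \<bar>h\<bar> < h0 \<Longrightarrow>
      sol b (a + \<alpha> * h + \<alpha>1 * h\<^sup>2) (c + \<eta> * h) (\<lambda>x. 1 / (\<Phi> b h x)\<^sup>2)"
  shows "\<exists>d\<Phi> C. 0 < C \<and> (\<forall>b. 0 \<le> b \<longrightarrow> b \<le> b_max \<longrightarrow> d\<Phi> b \<in> borel_measurable lborel \<and> (\<forall>x.
      ((\<lambda>h. \<Phi> b h x) has_real_derivative d\<Phi> b x) (at 0) \<and>
      \<bar>\<Phi> b 0 x - \<Phi> 0 0 x\<bar> \<le> C * b * exp (- (sqrt a / 2) * \<bar>x\<bar>) \<and>
      \<bar>d\<Phi> b x - d\<Phi> 0 x\<bar> \<le> C * b * exp (- (sqrt a / 2) * \<bar>x\<bar>)))"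
proof -
  define U where "U b h x = 1 / (\<Phi> b h x)\<^sup>2" for b h x
  have U: "sol b (a + \<alpha> * h + \<alpha>1 * h\<^sup>2) (c + \<eta> * h) (U b h)"
    if "0 \<le> b" "b \<le> b_max" "\<bar>h\<bar> < h0" for b h
    using sol[OF that] by (simp add: U_def[abs_def])
  obtain V C where C: "0 < C" and V: "\<And>b. 0 \<le> b \<Longrightarrow> b \<le> b_max \<Longrightarrow> V b \<in> borel_measurable lborel"
      "\<And>b x. 0 \<le> b \<Longrightarrow> b \<le> b_max \<Longrightarrow> ((\<lambda>h. U b h x) has_real_derivative V b x) (at 0)"
      "\<And>b x. 0 \<le> b \<Longrightarrow> b \<le> b_max \<Longrightarrow> \<bar>V b x\<bar> \<le> C * cosh (\<mu> * x)"
      "\<And>b x. 0 \<le> b \<Longrightarrow> b \<le> b_max \<Longrightarrow> \<bar>V b x - V 0 x\<bar> \<le> C * b * cosh (\<mu> * x)"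
      "\<And>b x. 0 \<le> b \<Longrightarrow> b \<le> b_max \<Longrightarrow> \<bar>U b 0 x - U 0 0 x\<bar> \<le> C * b * cosh (\<mu> * x)"
    using curve_derivative[OF h0 U] by blast
  have zero: "0 \<le> (0::real)" "0 \<le> b_max" using b_max_pos by auto
  have U0: "sol b a c (U b 0)" if "0 \<le> b" "b \<le> b_max" for b
    using U[OF that, of 0] h0 by simp
  have \<Phi>_eq: "\<Phi> b h x = U b h x powr (- (1 / 2))" if "0 \<le> b" "b \<le> b_max" "\<bar>h\<bar> < h0" for b h x
    unfolding U_def using inverse_square_powr[OF pos[OF that], of x 1] pos[OF that, of x] by simp
  define d\<Phi> where "d\<Phi> b x = - (1 / 2) * (U b 0 x powr (- (3 / 2)) * V b x)" for b x
  define \<kappa> where "\<kappa> = 2 * sqrt a"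
  have \<kappa>: "0 \<le> \<kappa>" "\<mu> \<le> 9 / 8 * \<kappa>" using \<mu>_bounds sol_box(5)[OF U0[OF zero]] by (auto simp: \<kappa>_def)
  define l where "l x = u_min / 2 * exp (\<kappa> * \<bar>x\<bar>)" for x
  have l: "0 < l x" for x using u_min_pos by (simp add: l_def)
  have l_powr: "l x powr s = (u_min / 2) powr s * exp (s * \<kappa> * \<bar>x\<bar>)" for s x
  proof -
    have "(u_min / 2 * exp (\<kappa> * \<bar>x\<bar>)) powr s = (u_min / 2) powr s * exp (\<kappa> * \<bar>x\<bar>) powr s"
      by (rule powr_mult)
    then show ?thesis unfolding l_def by (simp add: exp_powr_real mult_ac)
  qed
  have l_le: "l x \<le> U b 0 x" if "0 \<le> b" "b \<le> b_max" for b x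
  proof -
    have "exp (\<kappa> * \<bar>x\<bar>) / 2 \<le> cosh (\<kappa> * x)"
      using exp_abs_bounds_cosh(1)[of "\<kappa> * x"] \<kappa> by (simp add: abs_mult)
    then have "u_min * (exp (\<kappa> * \<bar>x\<bar>) / 2) \<le> u_min * cosh (\<kappa> * x)"
      using u_min_pos by (intro mult_left_mono) auto
    then show ?thesis using sol_ge_cosh[OF U0[OF that], of x] by (simp add: l_def \<kappa>_def)
  qed
  have cosh_le: "cosh (\<mu> * x) \<le> exp (\<mu> * \<bar>x\<bar>)" for x
    using exp_abs_bounds_cosh(2)[of "\<mu> * x"] \<mu>_bounds by (simp add: abs_mult)
  define A where "A s = (u_min / 2) powr s" for s
  have A: "0 \<le> A s" for s by (simp add: A_def)
  define E where "E x = exp (- (sqrt a / 2) * \<bar>x\<bar>)" for x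
  have decay1: "exp (- (3 / 2) * \<kappa> * \<bar>x\<bar>) * exp (\<mu> * \<bar>x\<bar>) \<le> E x"
    and decay2: "exp (- (5 / 2) * \<kappa> * \<bar>x\<bar>) * (exp (\<mu> * \<bar>x\<bar>) * exp (\<mu> * \<bar>x\<bar>)) \<le> E x" for x
  proof -
    have "(- (3 / 2) * \<kappa> + \<mu>) * \<bar>x\<bar> \<le> (- (\<kappa> / 4)) * \<bar>x\<bar>"
      "(- (5 / 2) * \<kappa> + (\<mu> + \<mu>)) * \<bar>x\<bar> \<le> (- (\<kappa> / 4)) * \<bar>x\<bar>"
      using \<kappa> by (intro mult_right_mono; simp)+
    then show "exp (- (3 / 2) * \<kappa> * \<bar>x\<bar>) * exp (\<mu> * \<bar>x\<bar>) \<le> E x"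
      "exp (- (5 / 2) * \<kappa> * \<bar>x\<bar>) * (exp (\<mu> * \<bar>x\<bar>) * exp (\<mu> * \<bar>x\<bar>)) \<le> E x"
      unfolding E_def exp_add[symmetric] by (simp_all add: \<kappa>_def algebra_simps)
  qed
  define B where "B = A (- (3 / 2)) * C + 3 / 2 * A (- (5 / 2)) * C * C"
  show ?thesis
  proof (intro exI[of _ d\<Phi>] exI[of _ "B + 1"] conjI allI impI)
    show "0 < B + 1" using A C by (simp add: B_def add_nonneg_pos)
    fix b assume b: "0 \<le> b" "b \<le> b_max"
    have "U b 0 \<in> borel_measurable lborel" by (rule sol_measurable[OF U0[OF b]])
    then show "d\<Phi> b \<in> borel_measurable lborel" unfolding d\<Phi>_def[abs_def] using V(1)[OF b] by measurable
    fix x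
    have Upos: "0 < U b 0 x" using sol_pos[OF U0[OF b]] .
    have root_deriv: "((\<lambda>h. U b h x powr (- (1 / 2))) has_real_derivative d\<Phi> b x) (at 0)"
      using DERIV_fun_powr[OF V(2)[OF b, of x], where r = "- (1 / 2)"] Upos by (simp add: d\<Phi>_def)
    have near: "\<forall>\<^sub>F h in nhds 0. \<Phi> b h x = U b h x powr (- (1 / 2))"
      unfolding eventually_nhds_metric using h0 \<Phi>_eq[OF b] by (intro exI[of _ h0]) auto
    show "((\<lambda>h. \<Phi> b h x) has_real_derivative d\<Phi> b x) (at 0)"
      using DERIV_cong_ev[OF refl near refl] root_deriv by blast
    have bound1: "l x powr (- (3 / 2)) * (C * b * cosh (\<mu> * x)) \<le> A (- (3 / 2)) * C * b * E x"
    proof -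
      have "exp (- (3 / 2) * \<kappa> * \<bar>x\<bar>) * cosh (\<mu> * x) \<le> exp (- (3 / 2) * \<kappa> * \<bar>x\<bar>) * exp (\<mu> * \<bar>x\<bar>)"
        by (intro mult_left_mono cosh_le) simp
      also have "\<dots> \<le> E x" by (rule decay1)
      finally have "exp (- (3 / 2) * \<kappa> * \<bar>x\<bar>) * cosh (\<mu> * x) \<le> E x" .
      then have "(A (- (3 / 2)) * C * b) * (exp (- (3 / 2) * \<kappa> * \<bar>x\<bar>) * cosh (\<mu> * x)) \<le> (A (- (3 / 2)) * C * b) * E x"
        using A C b by (intro mult_left_mono) auto
      then show ?thesis unfolding l_powr A_def[symmetric] by (simp only: mult_ac)
    qed
    have bound2: "3 / 2 * l x powr (- (5 / 2)) * (C * b * cosh (\<mu> * x)) * (C * cosh (\<mu> * x))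
        \<le> 3 / 2 * A (- (5 / 2)) * C * C * b * E x"
    proof -
      have "exp (- (5 / 2) * \<kappa> * \<bar>x\<bar>) * (cosh (\<mu> * x) * cosh (\<mu> * x)) \<le> exp (- (5 / 2) * \<kappa> * \<bar>x\<bar>) * (exp (\<mu> * \<bar>x\<bar>) * exp (\<mu> * \<bar>x\<bar>))"
        using cosh_le[of x] by (intro mult_left_mono mult_mono) auto
      also have "\<dots> \<le> E x" by (rule decay2)
      finally have "(3 / 2 * A (- (5 / 2)) * C * C * b) * (exp (- (5 / 2) * \<kappa> * \<bar>x\<bar>) * (cosh (\<mu> * x) * cosh (\<mu> * x)))
         \<le> (3 / 2 * A (- (5 / 2)) * C * C * b) * E x"
        using A C b by (intro mult_left_mono) auto
      then show ?thesis unfolding l_powr A_def[symmetric] by (simp only: mult_ac)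
    qed
    have E: "0 \<le> b * E x" using b by (simp add: E_def)
    have nn: "0 \<le> A (- (3 / 2)) * C * b * E x" "0 \<le> 3 / 2 * A (- (5 / 2)) * C * C * b * E x"
      using A C b by (auto simp: E_def)
    have total: "A (- (3 / 2)) * C * b * E x + 3 / 2 * A (- (5 / 2)) * C * C * b * E x \<le> (B + 1) * b * E x"
      using E by (simp add: B_def algebra_simps)
    show "\<bar>\<Phi> b 0 x - \<Phi> 0 0 x\<bar> \<le> (B + 1) * b * exp (- (sqrt a / 2) * \<bar>x\<bar>)"
    proof -
      have "\<bar>\<Phi> b 0 x - \<Phi> 0 0 x\<bar> = \<bar>U b 0 x powr (- (1 / 2)) - U 0 0 x powr (- (1 / 2))\<bar>"
        using \<Phi>_eq[OF b, of 0 x] \<Phi>_eq[OF zero, of 0 x] h0 by simp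
      also have "\<dots> \<le> 1 / 2 * l x powr (- (1 / 2) - 1) * \<bar>U b 0 x - U 0 0 x\<bar>"
        by (intro powr_neg_lipschitz l l_le b zero) simp
      also have "\<dots> \<le> 1 * l x powr (- (3 / 2)) * (C * b * cosh (\<mu> * x))"
        using V(5)[OF b, of x] by (intro mult_mono) auto
      also have "\<dots> \<le> A (- (3 / 2)) * C * b * E x" using bound1 by simp
      finally show ?thesis using total nn unfolding E_def by linarith
    qed
    show "\<bar>d\<Phi> b x - d\<Phi> 0 x\<bar> \<le> (B + 1) * b * exp (- (sqrt a / 2) * \<bar>x\<bar>)"
    proof -
      define s where "s = U b 0 x powr (- (3 / 2))"
      define t where "t = U 0 0 x powr (- (3 / 2))"
      have st: "\<bar>s - t\<bar> \<le> 3 / 2 * l x powr (- (5 / 2)) * (C * b * cosh (\<mu> * x))"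
      proof -
        have "\<bar>s - t\<bar> \<le> 3 / 2 * l x powr (- (3 / 2) - 1) * \<bar>U b 0 x - U 0 0 x\<bar>"
          unfolding s_def t_def by (intro powr_neg_lipschitz l l_le b zero) simp
        also have "\<dots> \<le> 3 / 2 * l x powr (- (5 / 2)) * (C * b * cosh (\<mu> * x))"
          using V(5)[OF b, of x] by (intro mult_mono) auto
        finally show ?thesis .
      qed
      have t: "0 \<le> t" "t \<le> l x powr (- (3 / 2))"
        unfolding t_def using l l_le[OF zero] by (auto intro!: powr_mono2')
      have "d\<Phi> b x - d\<Phi> 0 x = - (1 / 2) * ((s - t) * V b x + t * (V b x - V 0 x))"
        by (simp add: d\<Phi>_def s_def t_def algebra_simps)
      also have "\<bar>\<dots>\<bar> \<le> \<bar>s - t\<bar> * \<bar>V b x\<bar> + t * \<bar>V b x - V 0 x\<bar>"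
      proof -
        have "\<bar>(s - t) * V b x + t * (V b x - V 0 x)\<bar> \<le> \<bar>s - t\<bar> * \<bar>V b x\<bar> + t * \<bar>V b x - V 0 x\<bar>"
          using abs_triangle_ineq[of "(s - t) * V b x" "t * (V b x - V 0 x)"] t by (simp add: abs_mult)
        then show ?thesis by (simp add: abs_mult)
      qed
      also have "\<dots> \<le> 3 / 2 * l x powr (- (5 / 2)) * (C * b * cosh (\<mu> * x)) * (C * cosh (\<mu> * x))
          + l x powr (- (3 / 2)) * (C * b * cosh (\<mu> * x))"
        using C b(1) t(1) by (intro add_mono mult_mono[OF st V(3)[OF b]] mult_mono[OF t(2) V(4)[OF b]]) auto
      also have "\<dots> \<le> (B + 1) * b * E x" using bound1 bound2 total by linarith
      finally show ?thesis by (simp add: E_def)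
    qed
  qed
qed

section \<open>From pointwise decay to the norms\<close>
lemma integrable_exp_neg_abs:
  fixes l :: real
  assumes "0 < l"
  shows "integrable lborel (\<lambda>x. exp (- l * \<bar>x\<bar>))"
proof -
  have e: "integrable lborel (\<lambda>x. exponential_density l x)"
    using nn_integral_erlang_ith_moment[OF assms, where k = 0 and i = 0] assms
    by (intro integrableI_nonneg) auto
  then have "integrable lborel (\<lambda>x. exponential_density l (- x))"
    using lborel_integrable_real_affine[of "exponential_density l" "-1" 0] by simp
  then have "integrable lborel (\<lambda>x. (exponential_density l x + exponential_density l (- x)) / l)"
    using e by (intro integrable_divide Bochner_Integration.integrable_add)
  then show ?thesis
    by (rule Bochner_Integration.integrable_bound)
       (use assms in \<open>auto simp: exponential_density_def mult_ac\<close>)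
qed

lemma norms_of_exponential_decay:
  fixes f :: "real \<Rightarrow> real"
  assumes l: "0 < l" and K: "0 \<le> K" and f: "f \<in> borel_measurable lborel"
    and bound: "\<And>x. \<bar>f x\<bar> \<le> K * exp (- l * \<bar>x\<bar>)"
  shows "f \<in> L2" "L2_norm f \<le> K * sqrt (LINT x|lborel. exp (- (2 * l) * \<bar>x\<bar>))"
    "Linf_norm f \<le> ereal K"
proof -
  have int: "integrable lborel (\<lambda>x. K\<^sup>2 * exp (- (2 * l) * \<bar>x\<bar>))"
    using integrable_exp_neg_abs[of "2 * l"] l by simp
  have sq: "(f x)\<^sup>2 \<le> K\<^sup>2 * exp (- (2 * l) * \<bar>x\<bar>)" for x
  proof -
    have "(f x)\<^sup>2 \<le> (K * exp (- l * \<bar>x\<bar>))\<^sup>2"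
      using power_mono[OF bound[of x], of 2] by simp
    also have "\<dots> = K\<^sup>2 * exp (- (2 * l) * \<bar>x\<bar>)"
      by (simp add: power_mult_distrib mult_ac flip: exp_double)
    finally show ?thesis .
  qed
  have int_f: "integrable lborel (\<lambda>x. (f x)\<^sup>2)"
    by (rule Bochner_Integration.integrable_bound[OF int]) (use f sq K in auto)
  then show "f \<in> L2" using f by (simp add: L2_def)
  have "L2_norm f \<le> sqrt (LINT x|lborel. K\<^sup>2 * exp (- (2 * l) * \<bar>x\<bar>))"
    unfolding L2_norm_def by (intro real_sqrt_le_mono integral_mono int_f int sq)
  also have "\<dots> = K * sqrt (LINT x|lborel. exp (- (2 * l) * \<bar>x\<bar>))"
    using K by (simp add: real_sqrt_mult)
  finally show "L2_norm f \<le> K * sqrt (LINT x|lborel. exp (- (2 * l) * \<bar>x\<bar>))" .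
  have "\<bar>f x\<bar> \<le> K" for x
    using bound[of x] mult_left_mono[OF _ K, of "exp (- l * \<bar>x\<bar>)" 1] l by simp
  then show "Linf_norm f \<le> ereal K"
    unfolding Linf_norm_def using f by (intro esssup_I) auto
qed

lemma le_root4:
  fixes b :: real
  assumes "0 \<le> b" "b \<le> 1"
  shows "b \<le> root 4 b"
proof -
  have "b ^ 4 \<le> b ^ 1" using assms by (intro power_decreasing) auto
  then have "root 4 (b ^ 4) \<le> root 4 b" by simp
  then show ?thesis using assms by (simp add: real_root_power_cancel)
qed

theorem lemma2p5:
  fixes p \<omega> c :: real
    and \<phi> :: "real \<Rightarrow> real \<Rightarrow> real \<Rightarrow> real \<Rightarrow> real"
  assumes p: "p \<ge> 4"
    and wc: "c\<^sup>2 < 4 * \<omega>"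
    and profile: "\<And>b w k. b \<ge> 0 \<Longrightarrow> k\<^sup>2 < 4 * w \<Longrightarrow> is_profile p b w k (\<phi> b w k)"
  shows "param_differentiable \<phi> 0 \<omega> c \<and>
    (\<exists>C>0. \<forall>\<^sub>F b in at_right 0.
       Linf_norm (\<lambda>x. \<phi> b \<omega> c x - \<phi> 0 \<omega> c x) \<le> ereal (C * root 4 b) \<and>
       (\<lambda>x. \<phi> b \<omega> c x - \<phi> 0 \<omega> c x) \<in> L2 \<and>
       L2_norm (\<lambda>x. \<phi> b \<omega> c x - \<phi> 0 \<omega> c x) \<le> C * root 4 b \<and>
       param_differentiable \<phi> b \<omega> c \<and>
       (\<lambda>x. d_omega \<phi> b \<omega> c x - d_omega \<phi> 0 \<omega> c x) \<in> L2 \<and>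
       L2_norm (\<lambda>x. d_omega \<phi> b \<omega> c x - d_omega \<phi> 0 \<omega> c x) \<le> C * root 4 b \<and>
       (\<lambda>x. d_c \<phi> b \<omega> c x - d_c \<phi> 0 \<omega> c x) \<in> L2 \<and>
       L2_norm (\<lambda>x. d_c \<phi> b \<omega> c x - d_c \<phi> 0 \<omega> c x) \<le> C * root 4 b)"
proof -
  define a where "a = \<omega> - c\<^sup>2 / 4"
  have a: "0 < a" using wc by (simp add: a_def)
  \<comment> \<open>The growth rate is \<open>9 / 8\<close> of \<open>2 \<surd>a\<close>, slow enough for the differences of the profiles to decay;
    its square \<open>81 a / 16\<close> still exceeds four times the upper end \<open>9 a / 8\<close> of the box.\<close>
  interpret parameter_box p "3 / 4 * a" "9 / 8 * a" "\<bar>c\<bar> + 1" "9 / 4 * sqrt a"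
    using p a by unfold_locales (auto simp: power_mult_distrib power2_eq_square)
  have pos: "0 < \<phi> b w k x" if "0 \<le> b" "k\<^sup>2 < 4 * w" for b w k x
    using profile[OF that] by (simp add: is_profile_def)
  have domain: "k\<^sup>2 < 4 * w" if "\<bar>(w - k\<^sup>2 / 4) - a\<bar> \<le> a / 8" for w k
  proof -
    have "7 / 8 * a \<le> w - k\<^sup>2 / 4" using that by linarith
    then show ?thesis using a by linarith
  qed
  have sol_profile: "sol b (w - k\<^sup>2 / 4) k (\<lambda>x. 1 / (\<phi> b w k x)\<^sup>2)"
    if "0 \<le> b" "b \<le> b_max" "\<bar>(w - k\<^sup>2 / 4) - a\<bar> \<le> a / 8" "\<bar>k - c\<bar> \<le> 1" for b w k
  proof -
    have "7 / 8 * a \<le> w - k\<^sup>2 / 4" "w - k\<^sup>2 / 4 \<le> 9 / 8 * a" using that(3) by linarith+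
    moreover have "reciprocal_profile p b (w - k\<^sup>2 / 4) k (\<lambda>x. 1 / (\<phi> b w k x)\<^sup>2)"
      by (intro reciprocal_profile_of_profile[OF p] profile that(1) domain that(3))
    ultimately show ?thesis
      unfolding sol_def using that(1,2,4) a by linarith
  qed

  \<comment> \<open>The derivative in \<open>\<omega>\<close>: only \<open>a\<close> moves.\<close>
  define h1 where "h1 = min 1 (a / 8)"
  have h1: "0 < h1" "h1 \<le> 1" "h1 \<le> a / 8" using a by (auto simp: h1_def)
  have curve1: "\<omega> + h - c\<^sup>2 / 4 = a + 1 * h + 0 * h\<^sup>2" for h by (simp add: a_def)
  have near1: "\<bar>(\<omega> + h - c\<^sup>2 / 4) - a\<bar> \<le> a / 8" if "\<bar>h\<bar> < h1" for h
    using that h1 unfolding curve1 by simp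
  have pos1: "0 < \<phi> b (\<omega> + h) c x" if "0 \<le> b" "b \<le> b_max" "\<bar>h\<bar> < h1" for b h x
    by (intro pos that(1) domain near1[OF that(3)])
  have sol1: "sol b (a + 1 * h + 0 * h\<^sup>2) (c + 0 * h) (\<lambda>x. 1 / (\<phi> b (\<omega> + h) c x)\<^sup>2)"
    if "0 \<le> b" "b \<le> b_max" "\<bar>h\<bar> < h1" for b h
    using sol_profile[OF that(1,2), of "\<omega> + h" c] near1[OF that(3)] unfolding curve1 by simp
  have "\<exists>d\<Phi> C. 0 < C \<and> (\<forall>b. 0 \<le> b \<longrightarrow> b \<le> b_max \<longrightarrow> d\<Phi> b \<in> borel_measurable lborel \<and> (\<forall>x.
      ((\<lambda>h. \<phi> b (\<omega> + h) c x) has_real_derivative d\<Phi> b x) (at 0) \<and>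
      \<bar>\<phi> b (\<omega> + 0) c x - \<phi> 0 (\<omega> + 0) c x\<bar> \<le> C * b * exp (- (sqrt a / 2) * \<bar>x\<bar>) \<and>
      \<bar>d\<Phi> b x - d\<Phi> 0 x\<bar> \<le> C * b * exp (- (sqrt a / 2) * \<bar>x\<bar>)))"
    using a by (intro profile_curve_estimate[OF h1(1,2) _ _ pos1 sol1]) auto
  then obtain D1 C1 where C1: "0 < C1" and D1: "\<And>b. 0 \<le> b \<Longrightarrow> b \<le> b_max \<Longrightarrow> D1 b \<in> borel_measurable lborel"
      "\<And>b x. 0 \<le> b \<Longrightarrow> b \<le> b_max \<Longrightarrow> ((\<lambda>h. \<phi> b (\<omega> + h) c x) has_real_derivative D1 b x) (at 0)"
      "\<And>b x. 0 \<le> b \<Longrightarrow> b \<le> b_max \<Longrightarrow> \<bar>\<phi> b \<omega> c x - \<phi> 0 \<omega> c x\<bar> \<le> C1 * b * exp (- (sqrt a / 2) * \<bar>x\<bar>)"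
      "\<And>b x. 0 \<le> b \<Longrightarrow> b \<le> b_max \<Longrightarrow> \<bar>D1 b x - D1 0 x\<bar> \<le> C1 * b * exp (- (sqrt a / 2) * \<bar>x\<bar>)"
    unfolding add_0_right by blast

  \<comment> \<open>The derivative in \<open>c\<close>: now \<open>a\<close> moves along a parabola, and \<open>h2\<close> keeps it inside the box.\<close>
  define h2 where "h2 = min 1 (a / (8 * (\<bar>c\<bar> + 1)))"
  have h2: "0 < h2" "h2 \<le> 1" "(\<bar>c\<bar> + 1) * h2 \<le> a / 8"
  proof -
    show "0 < h2" "h2 \<le> 1" using a by (auto simp: h2_def)
    have "h2 \<le> a / (8 * (\<bar>c\<bar> + 1))" by (simp add: h2_def)
    moreover have "0 < 8 * (\<bar>c\<bar> + 1)" by simp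
    ultimately have "h2 * (8 * (\<bar>c\<bar> + 1)) \<le> a" by (simp only: pos_le_divide_eq)
    then show "(\<bar>c\<bar> + 1) * h2 \<le> a / 8" by (simp add: algebra_simps)
  qed
  have curve2: "\<omega> - (c + h)\<^sup>2 / 4 = a + (- c / 2) * h + (- 1 / 4) * h\<^sup>2" for h
    by (simp add: a_def power2_eq_square algebra_simps add_divide_distrib)
  have near2: "\<bar>(\<omega> - (c + h)\<^sup>2 / 4) - a\<bar> \<le> a / 8" if "\<bar>h\<bar> < h2" for h
  proof -
    have "\<bar>(- c / 2) * h + (- 1 / 4) * h\<^sup>2\<bar> \<le> \<bar>c\<bar> * \<bar>h\<bar> + \<bar>h\<bar>"
    proof -
      have "h\<^sup>2 \<le> \<bar>h\<bar>" using mult_left_mono[of "\<bar>h\<bar>" 1 "\<bar>h\<bar>"] that h2 by (simp add: power2_eq_square)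
      moreover have "\<bar>(- c / 2) * h\<bar> \<le> \<bar>c\<bar> * \<bar>h\<bar>" by (simp add: abs_mult)
      ultimately show ?thesis using zero_le_power2[of h] by linarith
    qed
    also have "\<dots> = (\<bar>c\<bar> + 1) * \<bar>h\<bar>" by (simp add: distrib_right)
    also have "\<dots> \<le> (\<bar>c\<bar> + 1) * h2" using that by (intro mult_left_mono) auto
    also have "\<dots> \<le> a / 8" by (rule h2)
    finally show ?thesis unfolding curve2 by simp
  qed
  have pos2: "0 < \<phi> b \<omega> (c + h) x" if "0 \<le> b" "b \<le> b_max" "\<bar>h\<bar> < h2" for b h x
    by (intro pos that(1) domain near2[OF that(3)])
  have sol2: "sol b (a + (- c / 2) * h + (- 1 / 4) * h\<^sup>2) (c + 1 * h) (\<lambda>x. 1 / (\<phi> b \<omega> (c + h) x)\<^sup>2)"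
    if "0 \<le> b" "b \<le> b_max" "\<bar>h\<bar> < h2" for b h
    using sol_profile[OF that(1,2), of \<omega> "c + h"] near2[OF that(3)] that(3) h2 unfolding curve2 by simp
  have "\<exists>d\<Phi> C. 0 < C \<and> (\<forall>b. 0 \<le> b \<longrightarrow> b \<le> b_max \<longrightarrow> d\<Phi> b \<in> borel_measurable lborel \<and> (\<forall>x.
      ((\<lambda>h. \<phi> b \<omega> (c + h) x) has_real_derivative d\<Phi> b x) (at 0) \<and>
      \<bar>\<phi> b \<omega> (c + 0) x - \<phi> 0 \<omega> (c + 0) x\<bar> \<le> C * b * exp (- (sqrt a / 2) * \<bar>x\<bar>) \<and>
      \<bar>d\<Phi> b x - d\<Phi> 0 x\<bar> \<le> C * b * exp (- (sqrt a / 2) * \<bar>x\<bar>)))"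
    using a by (intro profile_curve_estimate[OF h2(1,2) _ _ pos2 sol2]) auto
  then obtain D2 C2 where C2: "0 < C2" and D2: "\<And>b. 0 \<le> b \<Longrightarrow> b \<le> b_max \<Longrightarrow> D2 b \<in> borel_measurable lborel"
      "\<And>b x. 0 \<le> b \<Longrightarrow> b \<le> b_max \<Longrightarrow> ((\<lambda>h. \<phi> b \<omega> (c + h) x) has_real_derivative D2 b x) (at 0)"
      "\<And>b x. 0 \<le> b \<Longrightarrow> b \<le> b_max \<Longrightarrow> \<bar>D2 b x - D2 0 x\<bar> \<le> C2 * b * exp (- (sqrt a / 2) * \<bar>x\<bar>)"
    by blast

  have dw: "((\<lambda>w. \<phi> b w c x) has_real_derivative D1 b x) (at \<omega>)" if "0 \<le> b" "b \<le> b_max" for b x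
    using D1(2)[OF that, of x] DERIV_shift[of "\<lambda>w. \<phi> b w c x" "D1 b x" 0 \<omega>] by (simp add: add.commute)
  have dc: "((\<lambda>k. \<phi> b \<omega> k x) has_real_derivative D2 b x) (at c)" if "0 \<le> b" "b \<le> b_max" for b x
    using D2(2)[OF that, of x] DERIV_shift[of "\<lambda>k. \<phi> b \<omega> k x" "D2 b x" 0 c] by (simp add: add.commute)
  have diff: "param_differentiable \<phi> b \<omega> c" if "0 \<le> b" "b \<le> b_max" for b
    unfolding param_differentiable_def field_differentiable_def using dw[OF that] dc[OF that] by blast
  have d_omega_eq: "d_omega \<phi> b \<omega> c = D1 b" if "0 \<le> b" "b \<le> b_max" for b
    unfolding d_omega_def[abs_def] using DERIV_imp_deriv[OF dw[OF that]] by blast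
  have d_c_eq: "d_c \<phi> b \<omega> c = D2 b" if "0 \<le> b" "b \<le> b_max" for b
    unfolding d_c_def[abs_def] using DERIV_imp_deriv[OF dc[OF that]] by blast
  have zero: "0 \<le> (0::real)" "0 \<le> b_max" using b_max_pos by auto
  have meas: "\<phi> b \<omega> c \<in> borel_measurable lborel" if "0 \<le> b" for b
  proof -
    have "\<phi> b \<omega> c field_differentiable (at x)" for x
      using profile[OF that wc] by (simp add: is_profile_def solves_profile_eq_def)
    then have "continuous_on UNIV (\<phi> b \<omega> c)"
      by (simp add: continuous_at_imp_continuous_on field_differentiable_imp_continuous_at)
    then show ?thesis by (simp add: borel_measurable_continuous_onI)
  qed
  define J where "J = sqrt (LINT x|lborel. exp (- (2 * (sqrt a / 2)) * \<bar>x\<bar>))"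
  have J: "0 \<le> J" by (simp add: J_def)
  \<comment> \<open>Chosen to exceed \<open>C1\<close> for the supremum norm and \<open>C1 J\<close>, \<open>C2 J\<close> for the \<open>L\<^sup>2\<close> norms.\<close>
  define C where "C = (C1 + C2) * (1 + J)"
  have C: "0 < C" "C1 \<le> C" "C1 * J \<le> C" "C2 * J \<le> C"
    using C1 C2 J by (auto simp: C_def algebra_simps add_pos_nonneg)
  show ?thesis
  proof (intro conjI exI[of _ C])
    show "param_differentiable \<phi> 0 \<omega> c" by (rule diff[OF zero])
    have "\<forall>\<^sub>F b in at_right 0. 0 < b \<and> b < b_max"
      using b_max_pos by (auto simp: eventually_at_right_field)
    then show "\<forall>\<^sub>F b in at_right 0.
       Linf_norm (\<lambda>x. \<phi> b \<omega> c x - \<phi> 0 \<omega> c x) \<le> ereal (C * root 4 b) \<and>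
       (\<lambda>x. \<phi> b \<omega> c x - \<phi> 0 \<omega> c x) \<in> L2 \<and>
       L2_norm (\<lambda>x. \<phi> b \<omega> c x - \<phi> 0 \<omega> c x) \<le> C * root 4 b \<and>
       param_differentiable \<phi> b \<omega> c \<and>
       (\<lambda>x. d_omega \<phi> b \<omega> c x - d_omega \<phi> 0 \<omega> c x) \<in> L2 \<and>
       L2_norm (\<lambda>x. d_omega \<phi> b \<omega> c x - d_omega \<phi> 0 \<omega> c x) \<le> C * root 4 b \<and>
       (\<lambda>x. d_c \<phi> b \<omega> c x - d_c \<phi> 0 \<omega> c x) \<in> L2 \<and>
       L2_norm (\<lambda>x. d_c \<phi> b \<omega> c x - d_c \<phi> 0 \<omega> c x) \<le> C * root 4 b"
    proof eventually_elim
      case (elim b)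
      then have b: "0 \<le> b" "b \<le> b_max" by auto
      \<comment> \<open>All differences are of order \<open>b\<close>, and \<open>b \<le> root 4 b\<close> since \<open>b \<le> 1\<close>.\<close>
      have rate: "K * b \<le> C * root 4 b" if "K \<le> C" for K
        using that C(1) b le_root4[of b] b_max_le by (intro mult_mono) auto
      have sa: "0 < sqrt a / 2" using a by simp
      have C1b: "0 \<le> C1 * b" and C2b: "0 \<le> C2 * b" using C1 C2 b by auto
      note est = norms_of_exponential_decay[OF sa C1b borel_measurable_diff[OF meas[OF b(1)] meas[OF zero(1)]] D1(3)[OF b], folded J_def]
      note est_w = norms_of_exponential_decay[OF sa C1b borel_measurable_diff[OF D1(1)[OF b] D1(1)[OF zero]] D1(4)[OF b], folded J_def]
      note est_c = norms_of_exponential_decay[OF sa C2b borel_measurable_diff[OF D2(1)[OF b] D2(1)[OF zero]] D2(3)[OF b], folded J_def]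
      have r1: "C1 * b \<le> C * root 4 b" by (rule rate[OF C(2)])
      have r2: "C1 * b * J \<le> C * root 4 b" using rate[OF C(3)] by (simp only: mult_ac)
      have r3: "C2 * b * J \<le> C * root 4 b" using rate[OF C(4)] by (simp only: mult_ac)
      show ?case
        unfolding d_omega_eq[OF b] d_omega_eq[OF zero] d_c_eq[OF b] d_c_eq[OF zero]
        using est est_w est_c r1 r2 r3 diff[OF b] by (auto intro: order_trans)
    qed
  qed (use C in simp)
qed

end
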